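(* Let $\mathscr{A}$ be an abelian $C^*$-algebra and let $\mathcal{E}$ be a Hilbert $\mathscr{A}$-module. Then $T\mapsto |||T|||$ is a norm on the complex vector space $L(\mathcal{E})$.
   Context: A Hilbert $\mathscr{A}$-module $\mathcal{E}$ is a complex linear space and right $\mathscr{A}$-module with an $\mathscr{A}$-valued inner product $\langle\cdot,\cdot\rangle$ satisfying $\langle x,\alpha y+\beta z\rangle=\alpha\langle x,y\rangle+\beta\langle x,z\rangle$, $\langle x,ya\rangle=\langle x,y\rangle a$, $\langle x,y\rangle^*=\langle y,x\rangle$, $\langle x,x\rangle\ge 0$ with equality only if $x=0$ (for $x,y,z\in\mathcal{E}$, $a\in\mathscr{A}$, $\alpha,\beta\in\mathbb{C}$), complete in the norm $\|x\|=\|\langle x,x\rangle\|^{1/2}$. For $x\in\mathcal{E}$ put $|x|=\langle x,x\rangle^{1/2}\in\mathscr{A}$. $L(\mathcal{E})$ denotes the set of adjointable maps on $\mathcal{E}$: maps $T:\mathcal{E}\to\mathcal{E}$ for which there is $T^*:\mathcal{E}\to\mathcal{E}$ with $\langle Tx,y\rangle=\langle x,T^*y\rangle$ for all $x,y\in\mathcal{E}$ (such maps are automatically bounded and $\mathscr{A}$-linear). $\tau(\mathscr{A})$ is the set of characters of $\mathscr{A}$, i.e. nonzero $*$-homomorphisms $\varphi:\mathscr{A}\to\mathbb{C}$. For $T\in L(\mathcal{E})$ define $$|||T|||=\sup\{\varphi(|Tx|): x\in\mathcal{E},\ \varphi\in\tau(\mathscr{A}),\ \varphi(|x|)=1\}.$$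 If $\mathcal{E}=\{0\}$ this set is empty and the supremum is taken to be $0$. *)

theory Defs
  imports Complex_Main "HOL-Library.Function_Algebras"
begin

class complex_vector = ab_group_add +
  fixes scaleC :: "complex \<Rightarrow> 'a \<Rightarrow> 'a" (infixr "*\<^sub>C" 75)
  assumes scaleC_add_right: "c *\<^sub>C (x + y) = c *\<^sub>C x + c *\<^sub>C y"
    and scaleC_add_left: "(c + d) *\<^sub>C x = c *\<^sub>C x + d *\<^sub>C x"
    and scaleC_scaleC: "c *\<^sub>C (d *\<^sub>C x) = (c * d) *\<^sub>C x"
    and scaleC_one: "1 *\<^sub>C x = x"

interpretation complex_vector: vector_space "scaleC :: complex \<Rightarrow> 'a \<Rightarrow> 'a::complex_vector"
  by unfold_locales (simp_all add: scaleC_add_right scaleC_add_left scaleC_scaleC scaleC_one)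

instantiation "fun" :: (type, complex_vector) complex_vector
begin

definition scaleC_fun :: "complex \<Rightarrow> ('a \<Rightarrow> 'b) \<Rightarrow> 'a \<Rightarrow> 'b" where
  "scaleC_fun c f = (\<lambda>x. c *\<^sub>C f x)"

instance
  by standard
    (simp_all add: scaleC_fun_def fun_eq_iff scaleC_add_right scaleC_add_left scaleC_scaleC scaleC_one)

end

text \<open>C*-algebras; a unit is not required. Completeness and submultiplicativity of the norm
  come from the superclasses.\<close>

class cstar_algebra = complex_vector + real_normed_algebra + banach +
  fixes star :: "'a \<Rightarrow> 'a"
  assumes scaleR_scaleC: "r *\<^sub>R a = complex_of_real r *\<^sub>C a"
    and norm_scaleC: "norm (c *\<^sub>C a) = cmod c * norm a"
    and scaleC_mult_left: "(c *\<^sub>C a) * b = c *\<^sub>C (a * b)"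
    and scaleC_mult_right: "a * (c *\<^sub>C b) = c *\<^sub>C (a * b)"
    and star_add: "star (a + b) = star a + star b"
    and star_scaleC: "star (c *\<^sub>C a) = cnj c *\<^sub>C star a"
    and star_mult: "star (a * b) = star b * star a"
    and star_star: "star (star a) = a"
    and cstar_identity: "norm (star a * a) = (norm a)\<^sup>2"

class abelian_cstar_algebra = cstar_algebra + comm_ring

text \<open>In the unitization, \<open>1 - b\<close> is a two-sided inverse of \<open>1 - a\<close> iff \<open>b\<close> is a
  quasi-inverse of \<open>a\<close>. Hence the set below is the spectrum of \<open>a\<close> in the unitization. If the
  algebra already has a unit, this can differ from the usual spectrum only by the point \<open>0\<close>,
  which is irrelevant for positivity.\<close>

definition quasi_invertible :: "'a::cstar_algebra \<Rightarrow> bool" where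
  "quasi_invertible a \<longleftrightarrow> (\<exists>b. a + b - a * b = 0 \<and> a + b - b * a = 0)"

definition spectrum :: "'a::cstar_algebra \<Rightarrow> complex set" where
  "spectrum a = insert 0 {z. z \<noteq> 0 \<and> \<not> quasi_invertible (inverse z *\<^sub>C a)}"

definition cstar_positive :: "'a::cstar_algebra \<Rightarrow> bool" where
  "cstar_positive a \<longleftrightarrow> star a = a \<and> spectrum a \<subseteq> complex_of_real ` {0..}"

definition cstar_sqrt :: "'a::cstar_algebra \<Rightarrow> 'a" where
  "cstar_sqrt a = (THE b. cstar_positive b \<and> b * b = a)"

definition characters :: "('a::cstar_algebra \<Rightarrow> complex) set" where
  "characters = {\<phi>. (\<forall>a b. \<phi> (a + b) = \<phi> a + \<phi> b) \<and> (\<forall>c a. \<phi> (c *\<^sub>C a) = c * \<phi> a) \<and>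
     (\<forall>a b. \<phi> (a * b) = \<phi> a * \<phi> b) \<and> (\<forall>a. \<phi> (star a) = cnj (\<phi> a)) \<and> (\<exists>a. \<phi> a \<noteq> 0)}"

definition module_norm :: "('e \<Rightarrow> 'e \<Rightarrow> 'a::cstar_algebra) \<Rightarrow> 'e \<Rightarrow> real" where
  "module_norm ip x = sqrt (norm (ip x x))"

definition module_abs :: "('e \<Rightarrow> 'e \<Rightarrow> 'a::cstar_algebra) \<Rightarrow> 'e \<Rightarrow> 'a" where
  "module_abs ip x = cstar_sqrt (ip x x)"

locale hilbert_module =
  fixes act :: "'e::complex_vector \<Rightarrow> 'a::cstar_algebra \<Rightarrow> 'e"
    and ip :: "'e \<Rightarrow> 'e \<Rightarrow> 'a"
  assumes act_add_left: "act (x + y) a = act x a + act y a"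
    and act_add_right: "act x (a + b) = act x a + act x b"
    and act_mult: "act x (a * b) = act (act x a) b"
    and act_scaleC_left: "act (c *\<^sub>C x) a = c *\<^sub>C act x a"
    and act_scaleC_right: "act x (c *\<^sub>C a) = c *\<^sub>C act x a"
    and ip_linear: "ip x (c *\<^sub>C y + d *\<^sub>C z) = c *\<^sub>C ip x y + d *\<^sub>C ip x z"
    and ip_act: "ip x (act y a) = ip x y * a"
    and star_ip: "star (ip x y) = ip y x"
    and ip_positive: "cstar_positive (ip x x)"
    and ip_definite: "ip x x = 0 \<Longrightarrow> x = 0"
    and complete:
      "(\<forall>e>0. \<exists>N. \<forall>m\<ge>N. \<forall>n\<ge>N. module_norm ip (X m - X n) < e) \<Longrightarrow>
       \<exists>x. (\<lambda>n. module_norm ip (X n - x)) \<longlonglongrightarrow> 0"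

definition adjointable_maps :: "('e \<Rightarrow> 'e \<Rightarrow> 'a::cstar_algebra) \<Rightarrow> ('e \<Rightarrow> 'e) set" where
  "adjointable_maps ip = {T. \<exists>S. \<forall>x y. ip (T x) y = ip x (S y)}"

text \<open>\<open>\<phi> (module_abs ip (T x))\<close> is real and nonnegative, as characters map positive elements
  to nonnegative reals; \<open>Re\<close> only changes the type.\<close>

definition triple_norm_values ::
    "('e \<Rightarrow> 'e \<Rightarrow> 'a::cstar_algebra) \<Rightarrow> ('e \<Rightarrow> 'e) \<Rightarrow> real set" where
  "triple_norm_values ip T =
     {Re (\<phi> (module_abs ip (T x))) | x \<phi>. \<phi> \<in> characters \<and> \<phi> (module_abs ip x) = 1}"

definition triple_norm :: "('e \<Rightarrow> 'e \<Rightarrow> 'a::cstar_algebra) \<Rightarrow> ('e \<Rightarrow> 'e) \<Rightarrow> real" where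
  "triple_norm ip T =
     (if triple_norm_values ip T = {} then 0 else Sup (triple_norm_values ip T))"

definition is_norm_on :: "'v::complex_vector set \<Rightarrow> ('v \<Rightarrow> real) \<Rightarrow> bool" where
  "is_norm_on V N \<longleftrightarrow>
     (\<forall>v\<in>V. 0 \<le> N v) \<and>
     (\<forall>v\<in>V. N v = 0 \<longleftrightarrow> v = 0) \<and>
     (\<forall>v\<in>V. \<forall>c. N (c *\<^sub>C v) = cmod c * N v) \<and>
     (\<forall>v\<in>V. \<forall>w\<in>V. N (v + w) \<le> N v + N w)"

end

theory Submission
  imports Defs "HOL-Analysis.Weierstrass_Theorems"
begin

text \<open>
  By the Gelfand theory of \<open>\<A>\<close>, \<open>s\<^sub>\<phi> x = \<phi> |x|\<close> is the seminorm of the semi-inner product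
  \<open>\<phi> \<langle>x, y\<rangle>\<close>, and \<open>|||T|||\<close> is the least \<open>C \<ge> 0\<close> with \<open>s\<^sub>\<phi> (T x) \<le> C s\<^sub>\<phi> x\<close> for all
  \<open>\<phi>\<close> and \<open>x\<close>; the norm axioms follow from this. Finiteness comes from the boundedness of \<open>T\<close> in
  the module norm, made local at \<open>\<phi>\<close> by multiplying \<open>x\<close> with a cutoff function of \<open>\<langle>x, x\<rangle>\<close>.

  Characters are constructed without units or spectral radii. A C*-seminorm that is minimal
  among those attaining the norm of a given self-adjoint element is multiplicative, and by
  Ostrowski's elementary proof of the Gelfand-Mazur theorem (homogenized, so that no unit is
  needed) a multiplicative C*-seminorm is the absolute value of a character.
\<close>

section \<open>Multiplicative C*-seminorms\<close>

locale cstar_seminorm =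
  fixes p :: "'a::abelian_cstar_algebra \<Rightarrow> real"
  assumes nonneg: "0 \<le> p a"
    and triangle: "p (a + b) \<le> p a + p b"
    and scaleC: "p (c *\<^sub>C a) = cmod c * p a"
    and submult: "p (a * b) \<le> p a * p b"
    and cstar: "p (star a * a) = (p a)\<^sup>2"
    and le_norm: "p a \<le> norm a"
begin

lemma zero: "p 0 = 0"
  using scaleC[of 0 0] by simp

lemma minus: "p (- a) = p a"
  using scaleC[of "-1" a] by simp

text \<open>The C*-identity and submultiplicativity give
  \<open>(p a)\<^sup>2 \<le> p (star a) * p a\<close>. Cancelling \<open>p a\<close> yields one
  inequality, and applying it to \<open>star a\<close> yields the other.\<close>

lemma star: "p (star a) = p a"
proof -
  have *: "p a \<le> p (star a)" for a
  proof (cases "p a = 0")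
    case False
    then have "0 < p a" using nonneg[of a] by simp
    moreover have "p a * p a \<le> p (star a) * p a"
      using cstar[of a] submult[of "star a" a] by (simp add: power2_eq_square)
    ultimately show ?thesis by simp
  qed (simp add: nonneg)
  show ?thesis using *[of a] *[of "star a"] by (simp add: star_star)
qed

end

section \<open>Minimal C*-seminorms via Zorn's lemma\<close>

lemma cstar_seminorm_norm: "cstar_seminorm (norm :: 'a::abelian_cstar_algebra \<Rightarrow> real)"
  by unfold_locales (auto simp: norm_triangle_ineq norm_scaleC norm_mult_ineq cstar_identity)

text \<open>Seminorms that are nearly minimal at \<open>a\<close> and at \<open>b\<close> have a
  common lower bound inside the chain, and the triangle inequality or submultiplicativity of that
  single member passes to the infimum.\<close>

lemma cstar_seminorm_INF_chain:
  fixes C :: "('a::abelian_cstar_algebra \<Rightarrow> real) set"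
  assumes "C \<noteq> {}" and sn: "\<And>q. q \<in> C \<Longrightarrow> cstar_seminorm q"
    and chain: "\<And>q r. q \<in> C \<Longrightarrow> r \<in> C \<Longrightarrow> q \<le> r \<or> r \<le> q"
  shows "cstar_seminorm (\<lambda>a. INF q\<in>C. q a)"
proof -
  let ?p = "\<lambda>a. INF q\<in>C. q a"
  have bdd: "bdd_below ((\<lambda>q. q a) ` C)" for a
    using sn cstar_seminorm.nonneg by (intro bdd_belowI2[of _ 0]) blast
  have low: "?p a \<le> q a" if "q \<in> C" for q a
    by (rule cINF_lower[OF bdd that])
  have great: "m \<le> ?p a" if "\<And>q. q \<in> C \<Longrightarrow> m \<le> q a" for m a
    by (rule cINF_greatest[OF \<open>C \<noteq> {}\<close>]) (use that in auto)
  have pos: "0 \<le> ?p a" for a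
    using great sn cstar_seminorm.nonneg by blast
  have common: "\<exists>r\<in>C. r \<le> q1 \<and> r \<le> q2" if "q1 \<in> C" "q2 \<in> C" for q1 q2
    using chain[OF that] that by blast
  have eps: "\<exists>q\<in>C. q a < ?p a + e" if "e > 0" for a and e :: real
  proof (rule ccontr)
    assume "\<not> ?thesis"
    then have "?p a + e \<le> ?p a" by (intro great) (auto simp: not_less)
    then show False using that by simp
  qed
  \<comment> \<open>Only this inequality is proved directly; the reverse one comes from applying it
    to the scalar \<open>inverse c\<close>.\<close>
  have scale_le: "?p (c *\<^sub>C a) \<le> cmod c * ?p a" for c a
  proof (cases "c = 0")
    case True
    obtain q where q: "q \<in> C" using \<open>C \<noteq> {}\<close> by blast
    have "q (0 *\<^sub>C a) = 0" using cstar_seminorm.scaleC[OF sn[OF q], of 0 a] by simp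
    with low[OF q, of "0 *\<^sub>C a"] True show ?thesis by simp
  next
    case False
    have "?p (c *\<^sub>C a) / cmod c \<le> ?p a"
    proof (rule great)
      fix q assume q: "q \<in> C"
      show "?p (c *\<^sub>C a) / cmod c \<le> q a"
        using low[OF q, of "c *\<^sub>C a"] cstar_seminorm.scaleC[OF sn[OF q], of c a] False
        by (simp add: field_simps)
    qed
    then show ?thesis using False by (simp add: field_simps)
  qed
  show ?thesis
  proof
    fix a b :: 'a and c :: complex
    show "0 \<le> ?p a" by (rule pos)
    show "?p (a + b) \<le> ?p a + ?p b"
    proof (rule field_le_epsilon)
      fix e :: real assume "e > 0"
      then obtain q1 q2 where q: "q1 \<in> C" "q1 a < ?p a + e/2" "q2 \<in> C" "q2 b < ?p b + e/2"
        using eps[of "e/2"] by (meson half_gt_zero)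
      obtain r where r: "r \<in> C" "r \<le> q1" "r \<le> q2" using common q by blast
      have "?p (a + b) \<le> r (a + b)" by (rule low[OF r(1)])
      also have "\<dots> \<le> r a + r b" by (rule cstar_seminorm.triangle[OF sn[OF r(1)]])
      also have "\<dots> \<le> q1 a + q2 b" using r by (simp add: le_fun_def add_mono)
      finally show "?p (a + b) \<le> ?p a + ?p b + e" using q by simp
    qed
    show "?p (c *\<^sub>C a) = cmod c * ?p a"
    proof (cases "c = 0")
      case True
      then show ?thesis using scale_le[of c a] pos[of "c *\<^sub>C a"] by simp
    next
      case False
      then have "cmod c * ?p a \<le> ?p (c *\<^sub>C a)"
        using scale_le[of "inverse c" "c *\<^sub>C a"]
        by (simp add: scaleC_scaleC scaleC_one norm_inverse norm_divide field_simps)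
      then show ?thesis using scale_le[of c a] by simp
    qed
    show "?p (a * b) \<le> ?p a * ?p b"
    proof (rule LIMSEQ_le_const)
      show "(\<lambda>n. (?p a + inverse (real (Suc n))) * (?p b + inverse (real (Suc n)))) \<longlonglongrightarrow> ?p a * ?p b"
        using tendsto_mult[OF tendsto_add[OF tendsto_const[of "?p a"] LIMSEQ_inverse_real_of_nat]
          tendsto_add[OF tendsto_const[of "?p b"] LIMSEQ_inverse_real_of_nat]]
        by (simp only: add_0_right)
      have "?p (a * b) \<le> (?p a + inverse (real (Suc n))) * (?p b + inverse (real (Suc n)))" for n
      proof -
        let ?e = "inverse (real (Suc n))"
        have "?e > 0" by simp
        then obtain q1 q2 where q: "q1 \<in> C" "q1 a < ?p a + ?e" "q2 \<in> C" "q2 b < ?p b + ?e"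
          using eps[of ?e] by meson
        obtain r where r: "r \<in> C" "r \<le> q1" "r \<le> q2" using common q by blast
        have "r a \<le> ?p a + ?e" "r b \<le> ?p b + ?e"
          using r q by (auto simp: le_fun_def intro: order_trans less_imp_le)
        then have "r a * r b \<le> (?p a + ?e) * (?p b + ?e)"
          using cstar_seminorm.nonneg[OF sn[OF r(1)]] pos[of a] by (intro mult_mono) auto
        then show ?thesis
          using low[OF r(1), of "a * b"] cstar_seminorm.submult[OF sn[OF r(1)], of a b] by linarith
      qed
      then show "\<exists>N. \<forall>n\<ge>N. ?p (a * b) \<le> (?p a + inverse (real (Suc n))) * (?p b + inverse (real (Suc n)))"
        by blast
    qed
    show "?p (star a * a) = (?p a)\<^sup>2"
    proof (rule antisym)
      show "(?p a)\<^sup>2 \<le> ?p (star a * a)"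
      proof (rule great)
        fix q assume q: "q \<in> C"
        show "(?p a)\<^sup>2 \<le> q (star a * a)"
          unfolding cstar_seminorm.cstar[OF sn[OF q]] by (rule power_mono[OF low[OF q] pos])
      qed
      \<comment> \<open>The square root turns the bounds by \<open>(q a)\<^sup>2\<close> into a
        lower bound of the values \<open>q a\<close>, so that \<open>great\<close> applies.\<close>
      have "sqrt (?p (star a * a)) \<le> ?p a"
      proof (rule great)
        fix q assume q: "q \<in> C"
        have "?p (star a * a) \<le> (q a)\<^sup>2"
          using low[OF q, of "star a * a"] cstar_seminorm.cstar[OF sn[OF q]] by simp
        then show "sqrt (?p (star a * a)) \<le> q a"
          using cstar_seminorm.nonneg[OF sn[OF q]] by (simp add: real_le_lsqrt)
      qed
      then show "?p (star a * a) \<le> (?p a)\<^sup>2"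
        using pos sqrt_le_D by blast
    qed
    obtain q where q: "q \<in> C" using \<open>C \<noteq> {}\<close> by blast
    show "?p a \<le> norm a"
      using low[OF q, of a] cstar_seminorm.le_norm[OF sn[OF q], of a] by simp
  qed
qed

text \<open>Zorn's lemma for the reversed order. All members of a chain agree at \<open>x\<close>,
  hence so does their infimum; the empty chain is bounded by \<open>norm\<close>. Fixing the value
  at \<open>x\<close> keeps the minimal seminorm from vanishing when \<open>x\<close> is
  nonzero.\<close>

lemma exists_minimal_cstar_seminorm:
  fixes x :: "'a::abelian_cstar_algebra"
  obtains p where "cstar_seminorm p" "p x = norm x"
    "\<And>q. cstar_seminorm q \<Longrightarrow> q x = norm x \<Longrightarrow> q \<le> p \<Longrightarrow> q = p"
proof -
  define A where "A = {p. cstar_seminorm p \<and> p x = norm x}"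
  have "\<exists>m\<in>A. \<forall>a\<in>A. a \<le> m \<longrightarrow> a = m"
  proof (rule predicate_Zorn)
    show "partial_order_on A (relation_of (\<lambda>p q. q \<le> p) A)"
      by (rule partial_order_on_relation_ofI) auto
    fix C assume "C \<in> Chains (relation_of (\<lambda>p q. q \<le> p) A)"
    then have C: "C \<subseteq> A" and chain: "\<And>q r. q \<in> C \<Longrightarrow> r \<in> C \<Longrightarrow> q \<le> r \<or> r \<le> q"
      unfolding Chains_def relation_of_def by auto
    show "\<exists>u\<in>A. \<forall>a\<in>C. u \<le> a"
    proof (cases "C = {}")
      case True
      then show ?thesis using cstar_seminorm_norm by (auto simp: A_def)
    next
      case False
      have sn: "cstar_seminorm q" if "q \<in> C" for q using that C by (auto simp: A_def)
      let ?p = "\<lambda>a. INF q\<in>C. q a"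
      have "?p x = (INF q\<in>C. norm x)" using C by (intro INF_cong) (auto simp: A_def)
      then have "?p x = norm x" using False by simp
      moreover have "cstar_seminorm ?p" by (rule cstar_seminorm_INF_chain[OF False sn chain])
      ultimately have "?p \<in> A" by (simp add: A_def)
      moreover have "?p \<le> q" if "q \<in> C" for q
        unfolding le_fun_def using sn cstar_seminorm.nonneg
        by (intro allI cINF_lower[OF bdd_belowI2[of _ 0] that]) blast
      ultimately show ?thesis by blast
    qed
  qed
  then show ?thesis using that unfolding A_def by blast
qed

section \<open>Localization along powers of an element\<close>

lemma funpow_mult_add: "((*) b ^^ n) (a + c) = ((*) b ^^ n) a + ((*) b ^^ n) (c::'a::cstar_algebra)"
  by (induction n) (auto simp: distrib_left)

lemma funpow_mult_scaleC: "((*) b ^^ n) (k *\<^sub>C a) = k *\<^sub>C ((*) b ^^ n) (a::'a::cstar_algebra)"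
  by (induction n) (auto simp: scaleC_mult_right)

text \<open>Iterated multiplication stands in for powers of \<open>b\<close>, which would need a
  unit at exponent 0. By commutativity the factors \<open>b\<close> can be shared out between
  \<open>a\<close> and \<open>c\<close>.\<close>

lemma funpow_mult_mult:
  "((*) b ^^ (m + n)) (a * c) = ((*) b ^^ m) a * ((*) b ^^ n) (c::'a::abelian_cstar_algebra)"
proof (induction m)
  case 0
  show ?case by (induction n) (auto simp: mult.left_commute)
qed (simp add: mult.assoc)

lemma star_funpow_mult:
  "star b = b \<Longrightarrow> star (((*) b ^^ n) a) = ((*) b ^^ n) (star (a::'a::abelian_cstar_algebra))"
  by (induction n) (auto simp: star_mult mult.commute)

context cstar_seminorm
begin

text \<open>A C*-seminorm below \<open>\<lambda>a. p (b * a)\<close>, for self-adjoint \<open>b\<close> with \<open>p b \<le> 1\<close>.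
  If it still attains the norm at the element with respect to which \<open>p\<close> is minimal, then
  it equals \<open>p\<close>, so that multiplication by \<open>b\<close> preserves \<open>p\<close>.\<close>

definition localized :: "'a \<Rightarrow> 'a \<Rightarrow> real" where
  "localized b a = lim (\<lambda>n. p (((*) b ^^ n) a))"

context
  fixes b assumes b: "p b \<le> 1"
begin

lemma funpow_mult_decreasing: "p (((*) b ^^ Suc n) a) \<le> p (((*) b ^^ n) a)"
  using submult[of b "((*) b ^^ n) a"] mult_right_mono[OF b nonneg[of "((*) b ^^ n) a"]] by simp

lemma localized_LIMSEQ: "(\<lambda>n. p (((*) b ^^ n) a)) \<longlonglongrightarrow> localized b a"
proof -
  have "decseq (\<lambda>n. p (((*) b ^^ n) a))"
    by (rule decseq_SucI) (rule funpow_mult_decreasing)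
  then obtain L where "(\<lambda>n. p (((*) b ^^ n) a)) \<longlonglongrightarrow> L"
    using decseq_convergent[of _ 0] nonneg by metis
  then show ?thesis unfolding localized_def by (simp add: limI)
qed

text \<open>The sequence decreases, so its limit is at most the term with index 1. Starting at 1
  instead of 0 matters: once \<open>localized b = p\<close> is known, this yields
  \<open>p a \<le> p (b * a)\<close>.\<close>

lemma localized_le: "localized b a \<le> p (b * a)"
proof (rule LIMSEQ_le_const2[OF localized_LIMSEQ], intro exI allI impI)
  fix n :: nat assume n: "1 \<le> n"
  then show "p (((*) b ^^ n) a) \<le> p (b * a)"
  proof (induction n rule: dec_induct)
    case (step n)
    then show ?case using funpow_mult_decreasing[of n a] by linarith
  qed simp
qed

lemma cstar_seminorm_localized:
  assumes sa: "star b = b"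
  shows "cstar_seminorm (localized b)"
proof
  \<comment> \<open>Along even indices the \<open>2 * n\<close> factors \<open>b\<close> split
    evenly over a product of two elements, which gives submultiplicativity and the C*-identity in
    the limit.\<close>
  have dbl: "(\<lambda>n. p (((*) b ^^ (n + n)) a)) \<longlonglongrightarrow> localized b a" for a
    using LIMSEQ_subseq_LIMSEQ[OF localized_LIMSEQ, of "\<lambda>n. n + n" a]
    by (simp add: strict_mono_def o_def)
  fix a c :: 'a and k :: complex
  show "0 \<le> localized b a"
    by (rule LIMSEQ_le_const[OF localized_LIMSEQ]) (auto simp: nonneg)
  show "localized b (a + c) \<le> localized b a + localized b c"
    by (rule LIMSEQ_le[OF localized_LIMSEQ tendsto_add[OF localized_LIMSEQ localized_LIMSEQ]])
      (auto simp: funpow_mult_add triangle)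
  show "localized b (k *\<^sub>C a) = cmod k * localized b a"
    using localized_LIMSEQ[of "k *\<^sub>C a"] tendsto_mult_left[OF localized_LIMSEQ[of a], of "cmod k"]
    by (simp add: funpow_mult_scaleC scaleC LIMSEQ_unique)
  show "localized b (a * c) \<le> localized b a * localized b c"
    by (rule LIMSEQ_le[OF dbl tendsto_mult[OF localized_LIMSEQ localized_LIMSEQ]])
      (auto simp: funpow_mult_mult submult)
  have "(\<lambda>n. p (((*) b ^^ (n + n)) (star a * a))) = (\<lambda>n. (p (((*) b ^^ n) a))\<^sup>2)"
    using cstar by (simp add: funpow_mult_mult star_funpow_mult[OF sa, symmetric])
  then show "localized b (star a * a) = (localized b a)\<^sup>2"
    using dbl[of "star a * a"] tendsto_power[OF localized_LIMSEQ[of a], of 2]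
    by (simp add: LIMSEQ_unique)
  show "localized b a \<le> norm a"
    using localized_le[of a] submult[of b a] mult_right_mono[OF b nonneg[of a]] le_norm[of a]
    by linarith
qed

end

lemma p_funpow_self:
  assumes sa: "star b = b" and b: "p b = 1"
  shows "p (((*) b ^^ n) b) = 1"
proof -
  have le: "p (((*) b ^^ n) b) \<le> 1" for n
  proof (induction n)
    case (Suc n)
    then show ?case using funpow_mult_decreasing[where b = b and n = n and a = b] b by simp
  qed (simp add: b)
  \<comment> \<open>Two consecutive values are carried along: writing \<open>u n\<close> for the
    power of \<open>b\<close> with exponent \<open>n + 1\<close>, the square of
    \<open>u (n + 1)\<close> equals \<open>u n * u (n + 2)\<close>, so the C*-identity forces
    \<open>p (u (n + 2)) \<ge> 1\<close>.\<close>
  have "p (((*) b ^^ n) b) = 1 \<and> p (((*) b ^^ Suc n) b) = 1"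
  proof (induction n)
    case 0
    show ?case using cstar[of b] by (simp add: b sa)
  next
    case (Suc n)
    let ?u = "\<lambda>n. ((*) b ^^ n) b"
    have eq: "star (?u (Suc n)) * ?u (Suc n) = ?u n * ?u (Suc (Suc n))"
      using funpow_mult_mult[of "Suc n" "Suc n" b b b] funpow_mult_mult[of n "Suc (Suc n)" b b b]
      unfolding star_funpow_mult[OF sa] sa by simp
    have "1 = p (?u n * ?u (Suc (Suc n)))"
      using cstar[of "?u (Suc n)"] Suc unfolding eq by simp
    also have "\<dots> \<le> p (?u n) * p (?u (Suc (Suc n)))" by (rule submult)
    finally show ?case using Suc le[of "Suc (Suc n)"] by simp
  qed
  then show ?thesis by blast
qed

end

locale mult_cstar_seminorm = cstar_seminorm +
  assumes mult: "p (a * b) = p a * p b"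

text \<open>Multiplicativity of a minimal \<open>p\<close> is reached in three stages: for the
  factor \<open>x\<close>, whose normalized powers keep the value 1; for self-adjoint factors
  \<open>b\<close>, using multiplicativity at \<open>x\<close>; and for arbitrary factors by passing
  to \<open>star a * a\<close>.\<close>

lemma exists_mult_cstar_seminorm:
  fixes x :: "'a::abelian_cstar_algebra"
  assumes sa: "star x = x" and x: "x \<noteq> 0"
  obtains p where "mult_cstar_seminorm p" "p x = norm x"
proof -
  obtain p where "cstar_seminorm p" and px: "p x = norm x"
    and min: "\<And>q. cstar_seminorm q \<Longrightarrow> q x = norm x \<Longrightarrow> q \<le> p \<Longrightarrow> q = p"
    using exists_minimal_cstar_seminorm[of x] by blast
  interpret cstar_seminorm p by fact
  have loc: "p (b * a) = p a"
    if b: "star b = b" "p b = 1" and bx: "\<And>n. p (((*) b ^^ n) x) = norm x" for b a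
  proof -
    have "localized b x = norm x"
      using localized_LIMSEQ[of b x] b bx by (simp add: LIMSEQ_const_iff)
    moreover have "localized b \<le> p"
    proof (rule le_funI)
      fix a show "localized b a \<le> p a"
        using localized_le[of b a] submult[of b a] b by simp
    qed
    ultimately have "localized b = p"
      using min cstar_seminorm_localized[of b] b by simp
    then show ?thesis using localized_le[of b a] submult[of b a] b by simp
  qed
  have *: "p (b * a) = p b * p a"
    if b: "star b = b" and bx: "\<And>n. p b > 0 \<Longrightarrow> p (((*) (inverse (p b) *\<^sub>R b) ^^ n) x) = norm x"
    for b a
  proof (cases "p b = 0")
    case True
    then show ?thesis using submult[of b a] nonneg[of "b * a"] by simp
  next
    case False
    then have pos: "p b > 0" using nonneg[of b] by simp
    have "p ((inverse (p b) *\<^sub>R b) * a) = p a"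
      by (rule loc) (use b bx[OF pos] pos in \<open>auto simp: scaleR_scaleC star_scaleC scaleC norm_inverse\<close>)
    moreover have "(inverse (p b) *\<^sub>R b) * a = complex_of_real (inverse (p b)) *\<^sub>C (b * a)"
      by (simp only: scaleR_scaleC scaleC_mult_left)
    ultimately have "inverse (p b) * p (b * a) = p a"
      using pos by (simp only: scaleC norm_of_real) simp
    then show ?thesis using pos by (simp add: field_simps)
  qed
  have px0: "p x > 0" using px x by simp
  have multx: "p (x * a) = p x * p a" for a
  proof (rule *[OF sa])
    fix n
    let ?y = "inverse (p x) *\<^sub>R x"
    have y: "star ?y = ?y" "p ?y = 1"
      using px0 sa by (auto simp: scaleR_scaleC star_scaleC scaleC norm_inverse)
    have "x = complex_of_real (p x) *\<^sub>C ?y"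
      using px0 by (simp add: scaleR_scaleC scaleC_scaleC scaleC_one)
    then have "p (((*) ?y ^^ n) x) = p x * p (((*) ?y ^^ n) ?y)"
      using px0 by (metis funpow_mult_scaleC scaleC norm_of_real abs_of_pos)
    then show "p (((*) ?y ^^ n) x) = norm x" using p_funpow_self[OF y, of n] px by simp
  qed
  have multsa: "p (b * a) = p b * p a" if b: "star b = b" for b a
  proof (rule *[OF b])
    fix n assume pos: "p b > 0"
    let ?y = "inverse (p b) *\<^sub>R b"
    have y: "star ?y = ?y" "p ?y = 1"
      using pos b by (auto simp: scaleR_scaleC star_scaleC scaleC norm_inverse)
    \<comment> \<open>By \<open>multx\<close>, \<open>p x\<close> times the value of a power of
      \<open>?y\<close>, which is 1, is the value of a product; moving one factor \<open>?y\<close>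
      to the front and estimating it by 1 leaves the iterate applied to \<open>x\<close>.\<close>
    have "p x * p (((*) ?y ^^ n) ?y) = p (((*) ?y ^^ n) (x * ?y))"
      using multx[of "((*) ?y ^^ n) ?y"] funpow_mult_mult[of 0 n ?y x ?y] by simp
    also have "\<dots> = p (?y * ((*) ?y ^^ n) x)"
      using funpow_mult_mult[of 0 n ?y ?y x] by (simp add: mult.commute)
    also have "\<dots> \<le> p (((*) ?y ^^ n) x)" 
      using submult[of ?y "((*) ?y ^^ n) x"] y by simp
    finally have "p x \<le> p (((*) ?y ^^ n) x)" by (simp add: p_funpow_self[OF y])
    moreover have "p (((*) ?y ^^ n) x) \<le> p x"
    proof (induction n)
      case (Suc n)
      have "p ?y \<le> 1" using y by simp
      from funpow_mult_decreasing[OF this, where n = n and a = x] Suc show ?case by (rule order_trans)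
    qed simp
    ultimately show "p (((*) ?y ^^ n) x) = norm x" using px by simp
  qed
  have "p (a * b) = p a * p b" for a b
  proof -
    have "(p (a * b))\<^sup>2 = p ((star a * a) * (star b * b))"
      using cstar[of "a * b"] by (simp add: star_mult ac_simps)
    also have "\<dots> = (p a)\<^sup>2 * (p b)\<^sup>2"
      by (simp add: multsa star_mult star_star cstar)
    finally show ?thesis
      by (metis nonneg mult_nonneg_nonneg power_mult_distrib power2_eq_imp_eq)
  qed
  then have "mult_cstar_seminorm p" by unfold_locales
  then show ?thesis using px that by blast
qed

lemmas scaleC_diff_left = complex_vector.scale_left_diff_distrib
lemmas scaleC_diff_right = complex_vector.scale_right_diff_distrib
lemmas scaleC_minus_left = complex_vector.scale_minus_left

section \<open>The Gelfand-Mazur theorem by Ostrowski's method\<close>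

context mult_cstar_seminorm
begin

text \<open>Powers with exponent \<open>2 ^ k\<close> only: their differences factor by taking
  square roots repeatedly, without general roots of unity.\<close>

abbreviation squares :: "nat \<Rightarrow> 'a \<Rightarrow> 'a" where
  "squares k \<equiv> (\<lambda>x. x * x) ^^ k"

lemma p_squares: "p (squares k h) = p h ^ 2 ^ k"
  by (induction k) (auto simp: mult simp flip: power_add mult_2)

lemma squares_diff_factor:
  "squares (Suc k) h - d\<^sup>2 *\<^sub>C squares (Suc k) e
    = (squares k h - d *\<^sub>C squares k e) * (squares k h - (- d) *\<^sub>C squares k e)"
  by (simp add: algebra_simps scaleC_mult_left scaleC_mult_right scaleC_scaleC power2_eq_square
      scaleC_minus_left)

text \<open>The difference factors into two differences one level below, at the two square roots of
  \<open>z\<close>. The induction hypothesis for arbitrary \<open>z\<close> bounds both.\<close>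

lemma squares_diff_lower:
  assumes m: "0 \<le> m" "\<And>z. m \<le> p (h - z *\<^sub>C e)"
  shows "m ^ 2 ^ k \<le> p (squares k h - z *\<^sub>C squares k e)"
proof (induction k arbitrary: z)
  case 0
  then show ?case using m(2)[of z] by simp
next
  case (Suc k)
  have "m ^ 2 ^ Suc k = m ^ 2 ^ k * m ^ 2 ^ k"
    by (simp flip: power_add mult_2)
  also have "\<dots> \<le> p (squares k h - csqrt z *\<^sub>C squares k e) * p (squares k h - (- csqrt z) *\<^sub>C squares k e)"
    by (rule mult_mono[OF Suc Suc nonneg]) (use m(1) in simp)
  also have "\<dots> = p (squares (Suc k) h - z *\<^sub>C squares (Suc k) e)"
    using squares_diff_factor[of k h "csqrt z" e] by (simp add: mult)
  finally show ?case .
qed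

text \<open>Of the \<open>2 ^ k\<close> linear factors, one is \<open>h - z *\<^sub>C e\<close> and
  the others have value at least \<open>m\<close>. The extra factor \<open>m\<close> on the right
  avoids the exponent \<open>2 ^ k - 1\<close>.\<close>

lemma squares_diff_lower_mult:
  assumes m: "0 \<le> m" "\<And>z. m \<le> p (h - z *\<^sub>C e)"
  shows "m ^ 2 ^ k * p (h - z *\<^sub>C e) \<le> m * p (squares k h - z ^ 2 ^ k *\<^sub>C squares k e)"
proof (induction k)
  case (Suc k)
  let ?f = "\<lambda>d. p (squares k h - d *\<^sub>C squares k e)"
  have "m ^ 2 ^ Suc k * p (h - z *\<^sub>C e) = (m ^ 2 ^ k * p (h - z *\<^sub>C e)) * m ^ 2 ^ k"
    by (simp add: mult_2 power_add)
  also have "\<dots> \<le> (m * ?f (z ^ 2 ^ k)) * ?f (- (z ^ 2 ^ k))"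
    by (rule mult_mono[OF Suc squares_diff_lower[OF m]]) (use m(1) nonneg in auto)
  also have "\<dots> = m * p (squares (Suc k) h - (z ^ 2 ^ k)\<^sup>2 *\<^sub>C squares (Suc k) e)"
    using squares_diff_factor[of k h "z ^ 2 ^ k" e] by (simp add: mult)
  also have "(z ^ 2 ^ k)\<^sup>2 = z ^ 2 ^ Suc k"
    by (simp add: mult.commute flip: power_mult)
  finally show ?case .
qed simp

text \<open>The previous bound and the triangle inequality at exponent \<open>2 ^ k\<close> give
  \<open>m * (1 + (cmod z / m) ^ 2 ^ k)\<close> as an upper bound, which tends to \<open>m\<close>.
  A positive minimum is therefore constant on a disc of radius \<open>m\<close>.\<close>

lemma min_value_propagates:
  assumes e: "p e = 1" and m: "0 < m" "\<And>z. m \<le> p (h - z *\<^sub>C e)" "p h = m" and z: "cmod z < m"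
  shows "p (h - z *\<^sub>C e) = m"
proof (rule antisym)
  have "p (h - z *\<^sub>C e) \<le> m * (1 + (cmod z / m) ^ 2 ^ k)" for k
  proof -
    have "p (squares k h - z ^ 2 ^ k *\<^sub>C squares k e) \<le> p (squares k h) + p (z ^ 2 ^ k *\<^sub>C squares k e)"
      using triangle[of "squares k h" "- (z ^ 2 ^ k *\<^sub>C squares k e)"] minus by simp
    also have "\<dots> = m ^ 2 ^ k + cmod z ^ 2 ^ k"
      by (simp add: p_squares scaleC e m norm_power)
    finally have "m * p (squares k h - z ^ 2 ^ k *\<^sub>C squares k e) \<le> m * (m ^ 2 ^ k + cmod z ^ 2 ^ k)"
      using m(1) by simp
    then have "m ^ 2 ^ k * p (h - z *\<^sub>C e) \<le> m * (m ^ 2 ^ k + cmod z ^ 2 ^ k)"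
      using squares_diff_lower_mult[OF less_imp_le[OF m(1)] m(2), of k z] by linarith
    then show ?thesis using m(1) by (simp add: field_simps)
  qed
  moreover have "(\<lambda>k. m * (1 + (cmod z / m) ^ 2 ^ k)) \<longlonglongrightarrow> m * (1 + 0)"
  proof (intro tendsto_intros)
    have "(\<lambda>n. (cmod z / m) ^ n) \<longlonglongrightarrow> 0" using z m(1) by (intro LIMSEQ_power_zero) simp
    moreover have "strict_mono (\<lambda>k::nat. (2::nat) ^ k)" by (simp add: strict_mono_def)
    ultimately show "(\<lambda>k. (cmod z / m) ^ 2 ^ k) \<longlonglongrightarrow> 0"
      using LIMSEQ_subseq_LIMSEQ by (force simp: o_def)
  qed
  ultimately show "p (h - z *\<^sub>C e) \<le> m"
    using LIMSEQ_le_const[of _ "m * (1 + 0)"] by fastforce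
qed (use m in auto)

text \<open>A positive minimum of the distance from \<open>h\<close> to the multiples of
  \<open>e\<close> would spread from disc to disc, while the distance grows at least like
  \<open>cmod z - p h\<close>.\<close>

lemma Gelfand_Mazur:
  assumes e: "p e = 1"
  shows "\<exists>z. p (h - z *\<^sub>C e) = 0"
proof -
  define f where "f z = p (h - z *\<^sub>C e)" for z
  have lip: "f z - f w \<le> cmod (z - w)" for z w
    using triangle[of "h - w *\<^sub>C e" "(w - z) *\<^sub>C e"] scaleC[of "w - z" e]
    by (simp add: f_def e scaleC_diff_left norm_minus_commute)
  have dist: "dist (f z) (f w) \<le> dist z w" for z w
    using lip[of z w] lip[of w z] by (simp add: dist_norm abs_le_iff norm_minus_commute)
  have cont: "continuous_on (cball 0 (2 * p h)) f"
    unfolding continuous_on_iff using dist by (metis le_less_trans)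
  have ball: "(0::complex) \<in> cball 0 (2 * p h)" using nonneg by simp
  obtain z0 where z0: "\<And>z. z \<in> cball 0 (2 * p h) \<Longrightarrow> f z0 \<le> f z"
    using continuous_attains_inf[OF compact_cball _ cont] ball by blast
  have large: "cmod z - p h \<le> f z" for z
    using triangle[of "h - z *\<^sub>C e" "- h"] by (simp add: f_def minus scaleC e)
  \<comment> \<open>Outside the ball, \<open>large\<close> gives a value above
    \<open>p h = f 0\<close>, and 0 lies in the ball; so the minimum over the ball is
    global.\<close>
  have min: "f z0 \<le> f z" for z
  proof (cases "z \<in> cball 0 (2 * p h)")
    case False
    then show ?thesis using large[of z] z0[OF ball] by (simp add: f_def)
  qed (rule z0)
  have "f z0 = 0"
  proof (rule ccontr)
    assume "f z0 \<noteq> 0"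
    then have m: "0 < f z0" using nonneg[of "h - z0 *\<^sub>C e"] by (simp add: f_def)
    \<comment> \<open>The step length is half the radius \<open>f z0\<close>, so each point lies in
      the disc around its predecessor.\<close>
    define w where "w n = z0 + of_real (real n * (f z0 / 2))" for n :: nat
    have fw: "f (w n) = f z0" for n
    proof (induction n)
      case (Suc n)
      have "p ((h - w n *\<^sub>C e) - of_real (f z0 / 2) *\<^sub>C e) = f z0"
      proof (rule min_value_propagates[OF e m])
        show "f z0 \<le> p (h - w n *\<^sub>C e - z *\<^sub>C e)" for z
          using min[of "w n + z"] by (simp add: f_def scaleC_add_left diff_diff_eq)
        show "p (h - w n *\<^sub>C e) = f z0" using Suc by (simp add: f_def)
        show "cmod (complex_of_real (f z0 / 2)) < f z0" using m by (simp only: norm_of_real)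
      qed
      moreover have "w (Suc n) = w n + of_real (f z0 / 2)"
        by (simp add: w_def algebra_simps add_divide_distrib)
      ultimately show ?case by (simp add: f_def scaleC_add_left diff_diff_eq)
    qed (simp add: w_def)
    obtain n :: nat where "(f z0 + p h + cmod z0) / (f z0 / 2) < n"
      using reals_Archimedean2 by blast
    then have "f z0 + p h + cmod z0 < n * (f z0 / 2)" using m by (simp add: field_simps)
    moreover have "n * (f z0 / 2) \<le> cmod (w n) + cmod z0"
      using norm_triangle_ineq4[of "w n" z0] m by (simp add: w_def norm_mult norm_divide)
    ultimately show False using large[of "w n"] fw[of n] by simp
  qed
  then show ?thesis by (auto simp: f_def)
qed

text \<open>By Gelfand-Mazur every element is a unique multiple of a normalized \<open>e\<close>
  modulo the kernel of \<open>p\<close>; the coefficient is the desired functional up to a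
  phase.\<close>

lemma exists_character:
  assumes e: "p e \<noteq> 0"
  shows "\<exists>\<xi>\<in>characters. \<forall>a. cmod (\<xi> a) = p a"
proof -
  have "p (inverse (p e) *\<^sub>R e) = 1"
    using e nonneg[of e] by (simp add: scaleR_scaleC scaleC norm_inverse)
  then obtain e where e: "p e = 1" by blast
  obtain \<phi> where \<phi>: "\<And>h. p (h - \<phi> h *\<^sub>C e) = 0" using Gelfand_Mazur[OF e] by metis
  have uniq: "\<phi> h = w" if "p (h - w *\<^sub>C e) = 0" for h w
    using triangle[of "h - w *\<^sub>C e" "- (h - \<phi> h *\<^sub>C e)"] that \<phi>[of h]
    unfolding minus by (simp add: scaleC e flip: scaleC_diff_left)
  have p0: "p (a + b) = 0" if "p a = 0" "p b = 0" for a b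
    using triangle[of a b] that nonneg[of "a + b"] by simp
  have add: "\<phi> (a + b) = \<phi> a + \<phi> b" for a b
    using p0[OF \<phi>[of a] \<phi>[of b]] by (intro uniq) (simp add: scaleC_add_left algebra_simps)
  have scale: "\<phi> (c *\<^sub>C a) = c * \<phi> a" for c a
    using scaleC[of c "a - \<phi> a *\<^sub>C e"] \<phi>[of a]
    by (intro uniq) (simp add: scaleC_diff_right scaleC_scaleC)
  have abs: "cmod (\<phi> a) = p a" for a
    using triangle[of "a - \<phi> a *\<^sub>C e" "\<phi> a *\<^sub>C e"] triangle[of a "- (a - \<phi> a *\<^sub>C e)"] \<phi>[of a]
    unfolding minus by (simp add: scaleC e)
  \<comment> \<open>Modulo the kernel of \<open>p\<close>, \<open>e * e\<close> is
    \<open>\<mu> *\<^sub>C e\<close>, so \<open>\<phi>\<close> is multiplicative only up to the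
    factor \<open>\<mu>\<close>. Multiplying \<open>\<phi>\<close> by \<open>\<mu>\<close> repairs
    this and, as \<open>cmod \<mu> = 1\<close>, keeps absolute values.\<close>
  define \<mu> where "\<mu> = \<phi> (e * e)"
  have mu: "cmod \<mu> = 1" by (simp add: \<mu>_def abs mult e)
  have mult': "\<phi> (a * b) = \<mu> * \<phi> a * \<phi> b" for a b
  proof (rule uniq)
    have "p ((a - \<phi> a *\<^sub>C e) * b + (\<phi> a *\<^sub>C e * (b - \<phi> b *\<^sub>C e) + (\<phi> a * \<phi> b) *\<^sub>C (e * e - \<mu> *\<^sub>C e))) = 0"
      using \<phi> by (intro p0) (simp_all add: mult scaleC \<mu>_def)
    moreover have "(a - \<phi> a *\<^sub>C e) * b + (\<phi> a *\<^sub>C e * (b - \<phi> b *\<^sub>C e) + (\<phi> a * \<phi> b) *\<^sub>C (e * e - \<mu> *\<^sub>C e))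
        = a * b - (\<mu> * \<phi> a * \<phi> b) *\<^sub>C e"
      by (simp add: algebra_simps scaleC_mult_left scaleC_mult_right scaleC_scaleC scaleC_diff_right)
    ultimately show "p (a * b - (\<mu> * \<phi> a * \<phi> b) *\<^sub>C e) = 0" by simp
  qed
  define \<xi> where "\<xi> a = \<mu> * \<phi> a" for a
  have chi_abs: "cmod (\<xi> a) = p a" for a by (simp add: \<xi>_def norm_mult mu abs)
  have chi_add: "\<xi> (a + b) = \<xi> a + \<xi> b" and chi_scale: "\<xi> (c *\<^sub>C a) = c * \<xi> a"
    and chi_mult: "\<xi> (a * b) = \<xi> a * \<xi> b" for a b c
    by (simp_all add: \<xi>_def add scale mult' algebra_simps)
  \<comment> \<open>\<open>\<xi>\<close> and its adjoint are multiplicative functionals with the same kernel.\<close>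
  have chi_star: "\<xi> (star a) = cnj (\<xi> a)" for a
  proof -
    have chi_diff: "\<xi> (a - b) = \<xi> a - \<xi> b" for a b
      using chi_add[of "a - b" b] by simp
    define \<psi> where "\<psi> a = cnj (\<xi> (star a))" for a
    have psi_abs: "cmod (\<psi> a) = cmod (\<xi> a)" for a by (simp add: \<psi>_def chi_abs star)
    have psi_add: "\<psi> (a + b) = \<psi> a + \<psi> b" and psi_scale: "\<psi> (c *\<^sub>C a) = c * \<psi> a"
      and psi_mult: "\<psi> (a * b) = \<psi> a * \<psi> b" for a b c
      by (simp_all add: \<psi>_def star_add star_scaleC star_mult chi_add chi_scale chi_mult)
    have psi_diff: "\<psi> (a - b) = \<psi> a - \<psi> b" for a b
      using psi_add[of "a - b" b] by simp
    have e0: "\<xi> e \<noteq> 0" "\<psi> e \<noteq> 0" using chi_abs[of e] psi_abs[of e] e by auto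
    have cross: "\<xi> e * \<psi> b = \<xi> b * \<psi> e" for b
      using psi_abs[of "\<xi> e *\<^sub>C b - \<xi> b *\<^sub>C e"]
      by (simp add: chi_diff psi_diff chi_scale psi_scale)
    \<comment> \<open>By \<open>cross\<close> the two functionals are proportional; multiplicativity
      at \<open>e * e\<close> forces the ratio to be 1.\<close>
    have "\<xi> e * \<psi> e = \<xi> e * \<xi> e"
      using cross[of "e * e"] e0 by (simp add: chi_mult psi_mult)
    then have "\<psi> a = \<xi> a" using cross[of a] e0 by simp
    then show ?thesis by (metis \<psi>_def complex_cnj_cnj)
  qed
  have "\<xi> e \<noteq> 0" using chi_abs[of e] e by auto
  then have "\<xi> \<in> characters"
    unfolding characters_def using chi_add chi_scale chi_mult chi_star by blast
  then show ?thesis using chi_abs by blast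
qed

end

section \<open>Gelfand theory for abelian C*-algebras\<close>

lemma
  assumes "\<phi> \<in> characters"
  shows character_add: "\<phi> (a + b) = \<phi> a + \<phi> b"
    and character_scaleC: "\<phi> (c *\<^sub>C a) = c * \<phi> a"
    and character_mult: "\<phi> (a * b) = \<phi> a * \<phi> b"
    and character_star: "\<phi> (star a) = cnj (\<phi> a)"
  using assms unfolding characters_def by auto

lemma character_diff:
  assumes "\<phi> \<in> characters" shows "\<phi> (a - b) = \<phi> a - \<phi> b"
  using character_add[OF assms, of "a - b" b] by simp

lemma character_zero:
  assumes "\<phi> \<in> characters" shows "\<phi> 0 = 0"
  using character_diff[OF assms, of 0 0] by simp

text \<open>If the bound failed, scaling would give \<open>\<phi> b = 1\<close> with
  \<open>norm b < 1\<close>. The contraction sending \<open>x\<close> to \<open>b + b * x\<close>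
  then has a fixed point, at which \<open>\<phi> x = 1 + \<phi> x\<close>.\<close>

lemma character_norm_le:
  fixes a :: "'a::cstar_algebra"
  assumes \<phi>: "\<phi> \<in> characters"
  shows "cmod (\<phi> a) \<le> norm a"
proof (rule ccontr)
  assume "\<not> ?thesis"
  then have lt: "norm a < cmod (\<phi> a)" by simp
  then have nz: "\<phi> a \<noteq> 0" by auto
  define b where "b = inverse (\<phi> a) *\<^sub>C a"
  have b: "\<phi> b = 1" "norm b < 1"
    using lt nz by (auto simp: b_def character_scaleC[OF \<phi>] norm_scaleC norm_inverse norm_divide field_simps)
  have "\<forall>x y. dist (b + b * x) (b + b * y) \<le> norm b * dist x y"
    using norm_mult_ineq by (auto simp: dist_norm simp flip: right_diff_distrib)
  then obtain x where "b + b * x = x"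
    using banach_fix_type[of "norm b" "\<lambda>x. b + b * x"] b by auto
  then have "\<phi> x = \<phi> (b + b * x)" by simp
  then show False by (simp add: character_add[OF \<phi>] character_mult[OF \<phi>] b)
qed

text \<open>The seminorm construction needs a self-adjoint element; the C*-identities of
  \<open>p\<close> and \<open>norm\<close> transfer the result from \<open>star a * a\<close> to
  \<open>a\<close>.\<close>

lemma exists_character_norm:
  fixes a :: "'a::abelian_cstar_algebra"
  assumes "a \<noteq> 0"
  shows "\<exists>\<phi>\<in>characters. cmod (\<phi> a) = norm a"
proof -
  have nz: "star a * a \<noteq> 0" using assms cstar_identity[of a] by auto
  obtain p where "mult_cstar_seminorm p" and p: "p (star a * a) = norm (star a * a)"
    using exists_mult_cstar_seminorm[of "star a * a"] nz by (auto simp: star_mult star_star)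
  interpret mult_cstar_seminorm p by fact
  have "(p a)\<^sup>2 = (norm a)\<^sup>2" using p by (simp add: cstar cstar_identity)
  then have pa: "p a = norm a" using nonneg by simp
  then have "p a \<noteq> 0" using assms by simp
  then show ?thesis using exists_character pa by metis
qed

lemma characters_separate:
  fixes a b :: "'a::abelian_cstar_algebra"
  assumes "\<And>\<phi>. \<phi> \<in> characters \<Longrightarrow> \<phi> a = \<phi> b"
  shows "a = b"
proof (rule ccontr)
  assume "a \<noteq> b"
  then obtain \<phi> where "\<phi> \<in> characters" "cmod (\<phi> (a - b)) = norm (a - b)"
    using exists_character_norm[of "a - b"] by auto
  then show False using assms[of \<phi>] \<open>a \<noteq> b\<close> by (simp add: character_diff)
qed

lemma norm_le_characters:
  fixes a :: "'a::abelian_cstar_algebra"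
  assumes "\<And>\<phi>. \<phi> \<in> characters \<Longrightarrow> cmod (\<phi> a) \<le> C" "0 \<le> C"
  shows "norm a \<le> C"
proof (cases "a = 0")
  case False
  then obtain \<phi> where "\<phi> \<in> characters" "cmod (\<phi> a) = norm a"
    using exists_character_norm by blast
  then show ?thesis using assms(1)[of \<phi>] by simp
qed (simp add: assms)

section \<open>Functional calculus and positivity\<close>

lemma functional_calculus:
  fixes a :: "'a::abelian_cstar_algebra" and f :: "real \<Rightarrow> real"
  assumes a: "\<And>\<phi>. \<phi> \<in> characters \<Longrightarrow> \<phi> a \<in> complex_of_real ` {0..}"
    and f: "continuous_on {0..} f" "f 0 = 0"
  shows "\<exists>c. \<forall>\<phi>\<in>characters. \<phi> c = complex_of_real (f (Re (\<phi> a)))"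
proof -
  have poly: "\<exists>c. \<forall>\<phi>\<in>characters. \<phi> c = complex_of_real (g (Re (\<phi> a)) - g 0)"
    if "real_polynomial_function g" for g
    using that
  proof induction
    case (linear h)
    have "\<phi> (complex_of_real (h 1) *\<^sub>C a) = complex_of_real (h (Re (\<phi> a)) - h 0)"
      if \<phi>: "\<phi> \<in> characters" for \<phi>
    proof -
      interpret h: bounded_linear h by fact
      obtain t where "\<phi> a = complex_of_real t" using a[OF \<phi>] by auto
      moreover have "h t = t * h 1"
        using h.scaleR[of t 1] by simp
      ultimately show ?thesis
        by (simp add: character_scaleC[OF \<phi>] h.zero)
    qed
    then show ?case by blast
  next
    case (const c)
    then show ?case by (intro exI[of _ 0]) (simp add: character_zero)
  next
    case (add g h)
    then obtain c d where "\<forall>\<phi>\<in>characters. \<phi> c = complex_of_real (g (Re (\<phi> a)) - g 0)"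
      "\<forall>\<phi>\<in>characters. \<phi> d = complex_of_real (h (Re (\<phi> a)) - h 0)" by blast
    then show ?case by (intro exI[of _ "c + d"]) (simp add: character_add algebra_simps)
  next
    case (mult g h)
    then obtain c d where cd: "\<forall>\<phi>\<in>characters. \<phi> c = complex_of_real (g (Re (\<phi> a)) - g 0)"
      "\<forall>\<phi>\<in>characters. \<phi> d = complex_of_real (h (Re (\<phi> a)) - h 0)" by blast
    \<comment> \<open>Expand \<open>g * h - g 0 * h 0\<close> in the differences
      \<open>g - g 0\<close> and \<open>h - h 0\<close>, which are represented by \<open>c\<close>
      and \<open>d\<close>.\<close>
    let ?e = "c * d + (complex_of_real (g 0) *\<^sub>C d + complex_of_real (h 0) *\<^sub>C c)"
    have "\<phi> ?e = complex_of_real (g (Re (\<phi> a)) * h (Re (\<phi> a)) - g 0 * h 0)"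
      if \<phi>: "\<phi> \<in> characters" for \<phi>
    proof -
      have "\<phi> ?e = \<phi> c * \<phi> d + (complex_of_real (g 0) * \<phi> d + complex_of_real (h 0) * \<phi> c)"
        by (simp only: character_add[OF \<phi>] character_mult[OF \<phi>] character_scaleC[OF \<phi>])
      also have "\<dots> = complex_of_real (g (Re (\<phi> a)) * h (Re (\<phi> a)) - g 0 * h 0)"
        by (simp only: cd(1)[rule_format, OF \<phi>] cd(2)[rule_format, OF \<phi>] of_real_mult of_real_diff)
          (simp add: algebra_simps)
      finally show ?thesis .
    qed
    then show ?case by blast
  qed
  have "\<exists>c. \<forall>\<phi>\<in>characters. cmod (\<phi> c - f (Re (\<phi> a))) \<le> e" if e: "e > 0" for e
  proof -
    \<comment> \<open>Half of \<open>e\<close> pays for the approximation on the interval, the other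
      half for subtracting \<open>g 0\<close>, which is close to \<open>f 0 = 0\<close>.\<close>
    obtain g where g: "real_polynomial_function g"
      "\<And>x. x \<in> {0..norm a} \<Longrightarrow> \<bar>f x - g x\<bar> < e / 2"
    proof (rule Stone_Weierstrass_real_polynomial_function)
      show "continuous_on {0..norm a} f" by (rule continuous_on_subset[OF f(1)]) auto
      show "0 < e / 2" using e by simp
    qed auto
    obtain c where c: "\<forall>\<phi>\<in>characters. \<phi> c = complex_of_real (g (Re (\<phi> a)) - g 0)"
      using poly[OF g(1)] by blast
    have "cmod (\<phi> c - f (Re (\<phi> a))) \<le> e" if \<phi>: "\<phi> \<in> characters" for \<phi>
    proof -
      have "Re (\<phi> a) \<in> {0..norm a}"
        using a[OF \<phi>] character_norm_le[OF \<phi>, of a] by auto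
      then have "\<bar>f (Re (\<phi> a)) - g (Re (\<phi> a))\<bar> < e / 2" "\<bar>f 0 - g 0\<bar> < e / 2"
        using g(2) by auto
      then have "\<bar>g (Re (\<phi> a)) - g 0 - f (Re (\<phi> a))\<bar> \<le> e" using f(2) by linarith
      moreover have "\<phi> c - f (Re (\<phi> a)) = complex_of_real (g (Re (\<phi> a)) - g 0 - f (Re (\<phi> a)))"
        using c \<phi> by simp
      ultimately show ?thesis by (simp only: norm_of_real)
    qed
    then show ?thesis by blast
  qed
  then have "\<exists>c. \<forall>\<phi>\<in>characters. cmod (\<phi> c - f (Re (\<phi> a))) \<le> inverse (real (Suc n))" for n
    by simp
  then obtain c where c: "\<And>n \<phi>. \<phi> \<in> characters \<Longrightarrow> cmod (\<phi> (c n) - f (Re (\<phi> a))) \<le> inverse (real (Suc n))"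
    by metis
  \<comment> \<open>Characters determine the norm, so approximation that is uniform over characters
    gives a Cauchy sequence in the algebra.\<close>
  have "Cauchy c"
  proof (rule metric_CauchyI)
    fix e :: real assume "e > 0"
    then obtain N where N: "inverse (real (Suc N)) < e / 2"
      using reals_Archimedean[of "e / 2"] by auto
    have "dist (c m) (c n) < e" if "m \<ge> N" "n \<ge> N" for m n
    proof -
      have "norm (c m - c n) \<le> 2 * inverse (real (Suc N))"
      proof (rule norm_le_characters)
        fix \<phi> :: "'a \<Rightarrow> complex" assume \<phi>: "\<phi> \<in> characters"
        have "inverse (real (Suc m)) \<le> inverse (real (Suc N))" "inverse (real (Suc n)) \<le> inverse (real (Suc N))"
          using that by auto
        moreover have "cmod (\<phi> (c m) - \<phi> (c n))
            \<le> cmod (\<phi> (c m) - f (Re (\<phi> a))) + cmod (\<phi> (c n) - f (Re (\<phi> a)))"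
          using norm_triangle_ineq4[of "\<phi> (c m) - f (Re (\<phi> a))" "\<phi> (c n) - f (Re (\<phi> a))"] by simp
        ultimately show "cmod (\<phi> (c m - c n)) \<le> 2 * inverse (real (Suc N))"
          unfolding character_diff[OF \<phi>] using c[OF \<phi>, of m] c[OF \<phi>, of n] by linarith
      qed simp
      then show ?thesis using N by (simp add: dist_norm)
    qed
    then show "\<exists>M. \<forall>m\<ge>M. \<forall>n\<ge>M. dist (c m) (c n) < e" by blast
  qed
  then obtain d where d: "c \<longlonglongrightarrow> d" using Cauchy_convergent convergent_def by blast
  have "\<phi> d = f (Re (\<phi> a))" if \<phi>: "\<phi> \<in> characters" for \<phi>
  proof -
    have "(\<lambda>n. \<phi> (c n)) \<longlonglongrightarrow> \<phi> d"
    proof (rule metric_LIMSEQ_I)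
      fix r :: real assume "r > 0"
      then obtain N where "\<forall>n\<ge>N. dist (c n) d < r" using d metric_LIMSEQ_D by blast
      then show "\<exists>N. \<forall>n\<ge>N. dist (\<phi> (c n)) (\<phi> d) < r"
        using character_norm_le[OF \<phi>] by (metis character_diff[OF \<phi>] dist_norm le_less_trans)
    qed
    moreover have "(\<lambda>n. \<phi> (c n)) \<longlonglongrightarrow> f (Re (\<phi> a))"
    proof (rule LIM_zero_cancel, rule Lim_null_comparison)
      show "\<forall>\<^sub>F n in sequentially. cmod (\<phi> (c n) - f (Re (\<phi> a))) \<le> inverse (real (Suc n))"
        using c[OF \<phi>] by simp
    qed (rule LIMSEQ_inverse_real_of_nat)
    ultimately show ?thesis by (rule LIMSEQ_unique)
  qed
  then show ?thesis by blast
qed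

text \<open>After scaling to value 1 at \<open>\<phi>\<close>, a quasi-inverse \<open>b\<close>
  would give \<open>1 + \<phi> b - \<phi> b = 0\<close>.\<close>

lemma character_in_spectrum:
  assumes \<phi>: "\<phi> \<in> characters"
  shows "\<phi> a \<in> spectrum a"
proof (cases "\<phi> a = 0")
  case False
  have "\<not> quasi_invertible (inverse (\<phi> a) *\<^sub>C a)"
  proof
    let ?a = "inverse (\<phi> a) *\<^sub>C a"
    assume "quasi_invertible ?a"
    then obtain b where "?a + b - ?a * b = 0" by (auto simp: quasi_invertible_def)
    then have "\<phi> (?a + b - ?a * b) = 0" by (simp add: character_zero[OF \<phi>])
    then show False using False
      by (simp add: character_diff[OF \<phi>] character_add[OF \<phi>] character_mult[OF \<phi>] character_scaleC[OF \<phi>])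
  qed
  then show ?thesis using False by (simp add: spectrum_def)
qed (simp add: spectrum_def)

lemma character_positive:
  assumes "\<phi> \<in> characters" "cstar_positive a"
  shows "\<phi> a \<in> complex_of_real ` {0..}"
  using assms character_in_spectrum unfolding cstar_positive_def by blast

lemma cstar_positiveI:
  fixes a :: "'a::abelian_cstar_algebra"
  assumes a: "\<And>\<phi>. \<phi> \<in> characters \<Longrightarrow> \<phi> a \<in> complex_of_real ` {0..}"
  shows "cstar_positive a"
proof -
  have "star a = a"
    by (rule characters_separate) (use a in \<open>force simp: character_star\<close>)
  moreover have "quasi_invertible (inverse z *\<^sub>C a)"
    if z: "z \<notin> complex_of_real ` {0..}" for z
  proof -
    have nz: "complex_of_real t - z \<noteq> 0" if "t \<ge> 0" for t
      using z that by auto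
    have "z \<noteq> 0" using nz[of 0] by simp
    \<comment> \<open>\<open>h t\<close> solves \<open>t / z + h t - t / z * h t = 0\<close>, the
      equation of a quasi-inverse of \<open>a / z\<close> at each character. Its real and imaginary
      parts are realized separately, as the calculus takes real functions.\<close>
    define h where "h t = complex_of_real t / (complex_of_real t - z)" for t
    have cont: "continuous_on {0..} h"
      unfolding h_def using nz by (auto intro!: continuous_intros)
    have "\<exists>c. \<forall>\<phi>\<in>characters. \<phi> c = complex_of_real (Re (h (Re (\<phi> a))))"
      using a cont by (intro functional_calculus) (auto intro: continuous_intros simp: h_def)
    moreover have "\<exists>c. \<forall>\<phi>\<in>characters. \<phi> c = complex_of_real (Im (h (Re (\<phi> a))))"
      using a cont by (intro functional_calculus) (auto intro: continuous_intros simp: h_def)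
    ultimately obtain c d where cd: "\<forall>\<phi>\<in>characters. \<phi> c = complex_of_real (Re (h (Re (\<phi> a))))"
      "\<forall>\<phi>\<in>characters. \<phi> d = complex_of_real (Im (h (Re (\<phi> a))))" by blast
    define a' b where "a' = inverse z *\<^sub>C a" and "b = c + \<i> *\<^sub>C d"
    have "a' + b - a' * b = 0"
    proof (rule characters_separate)
      fix \<phi> :: "'a \<Rightarrow> complex" assume \<phi>: "\<phi> \<in> characters"
      obtain t where t: "t \<ge> 0" "\<phi> a = complex_of_real t" using a[OF \<phi>] by auto
      have "\<phi> b = h t"
        using cd \<phi> t by (simp add: b_def character_add[OF \<phi>] character_scaleC[OF \<phi>] complex_eq_iff)
      moreover have "\<phi> a' = t / z"
        using t by (simp add: a'_def character_scaleC[OF \<phi>] field_simps)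
      ultimately have "\<phi> (a' + b - a' * b) = t / z + h t - t / z * h t"
        by (simp add: character_diff[OF \<phi>] character_add[OF \<phi>] character_mult[OF \<phi>])
      also have "\<dots> = 0"
        using nz[OF t(1)] \<open>z \<noteq> 0\<close> by (simp add: h_def field_simps)
      finally show "\<phi> (a' + b - a' * b) = \<phi> 0"
        by (simp add: character_zero[OF \<phi>])
    qed
    then have "quasi_invertible a'"
      unfolding quasi_invertible_def by (metis mult.commute)
    then show ?thesis by (simp add: a'_def)
  qed
  ultimately show ?thesis unfolding cstar_positive_def spectrum_def by auto
qed

text \<open>The functional calculus supplies a positive root, and separation by characters makes it
  the only one, so the definite description in \<open>cstar_sqrt\<close> denotes it.\<close>

lemma character_cstar_sqrt:
  fixes a :: "'a::abelian_cstar_algebra"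
  assumes a: "cstar_positive a" and \<phi>: "\<phi> \<in> characters"
  shows "\<phi> (cstar_sqrt a) = complex_of_real (sqrt (Re (\<phi> a)))"
proof -
  have "\<exists>b. \<forall>\<phi>\<in>characters. \<phi> b = complex_of_real (sqrt (Re (\<phi> a)))"
    using character_positive[OF _ a] by (intro functional_calculus) (auto intro: continuous_intros)
  then obtain b where b: "\<And>\<phi>. \<phi> \<in> characters \<Longrightarrow> \<phi> b = complex_of_real (sqrt (Re (\<phi> a)))"
    by blast
  have re: "0 \<le> Re (\<phi> a)" "complex_of_real (Re (\<phi> a)) = \<phi> a" if "\<phi> \<in> characters" for \<phi>
    using character_positive[OF that a] by auto
  have "cstar_positive b" by (rule cstar_positiveI) (simp add: b re)
  moreover have "b * b = a"
    by (rule characters_separate)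
      (use re in \<open>simp add: character_mult b flip: of_real_mult\<close>)
  moreover have "c = b" if c: "cstar_positive c" "c * c = a" for c
  proof (rule characters_separate)
    fix \<phi> :: "'a \<Rightarrow> complex" assume \<phi>: "\<phi> \<in> characters"
    obtain t where t: "t \<ge> 0" "\<phi> c = complex_of_real t" using character_positive[OF \<phi> c(1)] by auto
    have "\<phi> a = complex_of_real (t * t)" using c(2) character_mult[OF \<phi>, of c c] t by auto
    then show "\<phi> c = \<phi> b" using t b[OF \<phi>] by simp
  qed
  ultimately have "cstar_sqrt a = b" unfolding cstar_sqrt_def by (intro the_equality) blast+
  then show ?thesis using b[OF \<phi>] by simp
qed

section \<open>Hilbert modules over abelian C*-algebras\<close>

text \<open>The discriminant argument for Cauchy-Schwarz. The minimizer is \<open>t = 1 / s\<close>;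
  for \<open>s = 0\<close> the expression is linear in \<open>t\<close> and becomes
  \<open>-1\<close> at the chosen point unless \<open>m = 0\<close>.\<close>

lemma quadratic_nonneg_imp_le:
  fixes a m s :: real
  assumes quad: "\<And>t. 0 \<le> a - 2 * t * m + t\<^sup>2 * m * s" and "0 \<le> m" "0 \<le> s"
  shows "m \<le> a * s"
proof (cases "s = 0")
  case True
  have "m = 0"
  proof (rule ccontr)
    assume "m \<noteq> 0"
    then show False using quad[of "(a + 1) / (2 * m)"] True by simp
  qed
  then show ?thesis using True by simp
next
  case False
  then have s: "0 < s" using \<open>0 \<le> s\<close> by simp
  have eq: "(1 / s)\<^sup>2 * m * s = m / s" using s by (simp add: power2_eq_square)
  have "0 \<le> a - 2 * (1 / s) * m + m / s" using quad[of "1 / s"] unfolding eq .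
  then have "m / s \<le> a" by simp
  then show ?thesis using s by (simp add: pos_divide_le_eq)
qed

text \<open>For characters this is \<open>\<phi> |x|\<close>, by
  \<open>character_module_abs\<close>, written so that the square root is taken in the
  reals.\<close>

definition character_seminorm ::
    "('e \<Rightarrow> 'e \<Rightarrow> 'a::cstar_algebra) \<Rightarrow> ('a \<Rightarrow> complex) \<Rightarrow> 'e \<Rightarrow> real" where
  "character_seminorm ip \<phi> x = sqrt (Re (\<phi> (ip x x)))"

locale abelian_hilbert_module = hilbert_module act ip
  for act :: "'e::complex_vector \<Rightarrow> 'a::abelian_cstar_algebra \<Rightarrow> 'e" and ip
begin

abbreviation "sn \<equiv> character_seminorm ip"
abbreviation "mn \<equiv> module_norm ip"

lemma ip_add_right: "ip x (y + z) = ip x y + ip x z"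
  using ip_linear[of x 1 y 1 z] by (simp add: scaleC_one)

lemma ip_scaleC_right: "ip x (c *\<^sub>C y) = c *\<^sub>C ip x y"
  using ip_linear[of x c y 0 y] by simp

lemma ip_diff_right: "ip x (y - z) = ip x y - ip x z"
  using ip_add_right[of x "y - z" z] by simp

lemma ip_add_left: "ip (x + y) z = ip x z + ip y z"
  by (metis ip_add_right star_ip star_add)

lemma ip_scaleC_left: "ip (c *\<^sub>C x) y = cnj c *\<^sub>C ip x y"
  by (metis ip_scaleC_right star_ip star_scaleC)

lemma ip_diff_left: "ip (x - y) z = ip x z - ip y z"
  using ip_add_left[of "x - y" y z] by simp

lemma ip_zero [simp]: "ip x 0 = 0" "ip 0 x = 0"
  using ip_diff_right[of x 0 0] ip_diff_left[of 0 0 x] by simp_all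

lemma ip_act_left: "ip (act x a) y = star a * ip x y"
  by (metis ip_act star_ip star_mult)

lemma ip_eqI:
  assumes "\<And>y. ip u y = ip v y" shows "u = v"
  using ip_definite[of "u - v"] assms[of "u - v"] by (simp add: ip_diff_left)

lemma character_module_abs:
  "\<phi> \<in> characters \<Longrightarrow> \<phi> (module_abs ip x) = complex_of_real (sn \<phi> x)"
  unfolding module_abs_def character_seminorm_def by (rule character_cstar_sqrt[OF ip_positive])

context
  fixes \<phi> :: "'a \<Rightarrow> complex" assumes \<phi>: "\<phi> \<in> characters"
begin

lemma character_ip_self: "\<phi> (ip x x) = complex_of_real ((sn \<phi> x)\<^sup>2)"
  using character_positive[OF \<phi> ip_positive[of x]]
  by (auto simp: character_seminorm_def simp flip: of_real_power)

lemma character_seminorm_nonneg: "0 \<le> sn \<phi> x"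
  using character_positive[OF \<phi> ip_positive[of x]] by (auto simp: character_seminorm_def)

lemma character_seminorm_add_square:
  "(sn \<phi> (x + y))\<^sup>2 = (sn \<phi> x)\<^sup>2 + 2 * Re (\<phi> (ip x y)) + (sn \<phi> y)\<^sup>2"
proof -
  have "\<phi> (ip y x) = cnj (\<phi> (ip x y))" by (metis character_star[OF \<phi>] star_ip)
  then have "complex_of_real ((sn \<phi> (x + y))\<^sup>2)
      = complex_of_real ((sn \<phi> x)\<^sup>2) + (\<phi> (ip x y) + cnj (\<phi> (ip x y))) + complex_of_real ((sn \<phi> y)\<^sup>2)"
    unfolding character_ip_self[symmetric] ip_add_left ip_add_right character_add[OF \<phi>] by simp
  also have "\<dots> = complex_of_real ((sn \<phi> x)\<^sup>2 + 2 * Re (\<phi> (ip x y)) + (sn \<phi> y)\<^sup>2)"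
    by (simp add: complex_add_cnj)
  finally show ?thesis by (simp only: of_real_eq_iff)
qed

lemma character_seminorm_scaleC: "sn \<phi> (c *\<^sub>C x) = cmod c * sn \<phi> x"
proof -
  have "\<phi> (ip (c *\<^sub>C x) (c *\<^sub>C x)) = (cnj c * c) * \<phi> (ip x x)"
    by (simp add: ip_scaleC_left ip_scaleC_right scaleC_scaleC character_scaleC[OF \<phi>])
  also have "cnj c * c = complex_of_real ((cmod c)\<^sup>2)"
    by (metis complex_norm_square mult.commute)
  also have "\<dots> * \<phi> (ip x x) = complex_of_real ((cmod c * sn \<phi> x)\<^sup>2)"
    by (simp add: character_ip_self power_mult_distrib)
  finally have "(sn \<phi> (c *\<^sub>C x))\<^sup>2 = (cmod c * sn \<phi> x)\<^sup>2"
    unfolding character_ip_self by (simp only: of_real_eq_iff)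
  then show ?thesis using character_seminorm_nonneg by (simp add: power2_eq_iff_nonneg)
qed

lemma character_seminorm_act: "sn \<phi> (act x a) = cmod (\<phi> a) * sn \<phi> x"
proof -
  have "\<phi> (ip (act x a) (act x a)) = (cnj (\<phi> a) * \<phi> a) * \<phi> (ip x x)"
    by (simp add: ip_act ip_act_left character_mult[OF \<phi>] character_star[OF \<phi>])
  also have "cnj (\<phi> a) * \<phi> a = complex_of_real ((cmod (\<phi> a))\<^sup>2)"
    by (metis complex_norm_square mult.commute)
  also have "\<dots> * \<phi> (ip x x) = complex_of_real ((cmod (\<phi> a) * sn \<phi> x)\<^sup>2)"
    by (simp add: character_ip_self power_mult_distrib)
  finally have "(sn \<phi> (act x a))\<^sup>2 = (cmod (\<phi> a) * sn \<phi> x)\<^sup>2"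
    unfolding character_ip_self by (simp only: of_real_eq_iff)
  then show ?thesis using character_seminorm_nonneg by (simp add: power2_eq_iff_nonneg)
qed

lemma character_Cauchy_Schwarz: "cmod (\<phi> (ip x y)) \<le> sn \<phi> x * sn \<phi> y"
proof -
  define B where "B = \<phi> (ip x y)"
  have "(cmod B)\<^sup>2 \<le> (sn \<phi> x)\<^sup>2 * (sn \<phi> y)\<^sup>2"
  proof (rule quadratic_nonneg_imp_le)
    fix t :: real
    \<comment> \<open>The factor \<open>cnj B\<close> aligns the phase, making the cross term the
      real number \<open>- t * (cmod B)\<^sup>2\<close>.\<close>
    define c where "c = - complex_of_real t * cnj B"
    have "\<phi> (ip x (c *\<^sub>C y)) = c * B"
      by (simp add: ip_scaleC_right character_scaleC[OF \<phi>] B_def)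
    also have "\<dots> = complex_of_real (- t * (cmod B)\<^sup>2)"
      by (simp add: c_def mult.commute flip: complex_norm_square)
    finally have "Re (\<phi> (ip x (c *\<^sub>C y))) = - t * (cmod B)\<^sup>2"
      by (simp only: Re_complex_of_real)
    moreover have "(sn \<phi> (c *\<^sub>C y))\<^sup>2 = t\<^sup>2 * (cmod B)\<^sup>2 * (sn \<phi> y)\<^sup>2"
      unfolding character_seminorm_scaleC by (simp add: c_def norm_mult power_mult_distrib)
    ultimately show "0 \<le> (sn \<phi> x)\<^sup>2 - 2 * t * (cmod B)\<^sup>2 + t\<^sup>2 * (cmod B)\<^sup>2 * (sn \<phi> y)\<^sup>2"
      using character_seminorm_add_square[of x "c *\<^sub>C y"] zero_le_power2[of "sn \<phi> (x + c *\<^sub>C y)"]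
      by linarith
  qed simp_all
  then have "(cmod B)\<^sup>2 \<le> (sn \<phi> x * sn \<phi> y)\<^sup>2" by (simp only: power_mult_distrib)
  then show ?thesis
    unfolding B_def by (rule power2_le_imp_le) (simp add: character_seminorm_nonneg)
qed

lemma character_seminorm_triangle: "sn \<phi> (x + y) \<le> sn \<phi> x + sn \<phi> y"
proof (rule power2_le_imp_le)
  have "Re (\<phi> (ip x y)) \<le> sn \<phi> x * sn \<phi> y"
    using character_Cauchy_Schwarz[of x y] complex_Re_le_cmod order_trans by blast
  then show "(sn \<phi> (x + y))\<^sup>2 \<le> (sn \<phi> x + sn \<phi> y)\<^sup>2"
    unfolding character_seminorm_add_square by (simp add: power2_sum)
qed (simp add: character_seminorm_nonneg)

lemma character_seminorm_le_module_norm: "sn \<phi> x \<le> mn x"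
  unfolding character_seminorm_def module_norm_def
  using character_norm_le[OF \<phi>, of "ip x x"] complex_Re_le_cmod order_trans by fastforce

end

lemma module_norm_nonneg: "0 \<le> mn x"
  by (simp add: module_norm_def)

lemma module_norm_zero: "mn 0 = 0"
  by (simp add: module_norm_def)

lemma module_norm_le:
  assumes "\<And>\<phi>. \<phi> \<in> characters \<Longrightarrow> sn \<phi> x \<le> C" "0 \<le> C"
  shows "mn x \<le> C"
proof -
  have "norm (ip x x) \<le> C\<^sup>2"
  proof (rule norm_le_characters)
    fix \<phi> :: "'a \<Rightarrow> complex" assume \<phi>: "\<phi> \<in> characters"
    show "cmod (\<phi> (ip x x)) \<le> C\<^sup>2"
      using power_mono[OF assms(1)[OF \<phi>] character_seminorm_nonneg[OF \<phi>], of 2]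
      by (simp add: character_ip_self[OF \<phi>] norm_power)
  qed simp
  then show ?thesis unfolding module_norm_def using assms(2) by (simp add: real_le_lsqrt)
qed

lemma module_norm_triangle: "mn (x + y) \<le> mn x + mn y"
proof (rule module_norm_le)
  fix \<phi> :: "'a \<Rightarrow> complex" assume \<phi>: "\<phi> \<in> characters"
  show "sn \<phi> (x + y) \<le> mn x + mn y"
    by (rule order_trans[OF character_seminorm_triangle[OF \<phi>] add_mono])
      (rule character_seminorm_le_module_norm[OF \<phi>])+
qed (simp add: module_norm_nonneg)

lemma module_norm_scaleC: "mn (c *\<^sub>C x) = cmod c * mn x"
  by (simp add: module_norm_def ip_scaleC_left ip_scaleC_right norm_scaleC real_sqrt_mult
      complex_mod_mult_cnj)

lemma module_norm_minus_commute: "mn (x - y) = mn (y - x)"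
  using module_norm_scaleC[of "-1" "x - y"] by simp

lemma module_Cauchy_Schwarz: "norm (ip x y) \<le> mn x * mn y"
proof (rule norm_le_characters)
  fix \<phi> :: "'a \<Rightarrow> complex" assume \<phi>: "\<phi> \<in> characters"
  show "cmod (\<phi> (ip x y)) \<le> mn x * mn y"
    by (rule order_trans[OF character_Cauchy_Schwarz[OF \<phi>] mult_mono])
      (simp_all add: character_seminorm_le_module_norm[OF \<phi>] character_seminorm_nonneg[OF \<phi>]
        module_norm_nonneg)
qed (simp add: module_norm_nonneg)

lemma norm_ip_self: "norm (ip x x) = (mn x)\<^sup>2"
  by (simp add: module_norm_def)

text \<open>The bound is the tail of a geometric series. At index \<open>Suc n\<close> it equals
  half of \<open>(1 / 3) ^ n\<close>, which is what the gliding hump below uses.\<close>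

lemma geometric_steps_converge:
  assumes step: "\<And>n. mn (x (Suc n) - x n) \<le> (1 / 3) ^ n"
  shows "\<exists>l. \<forall>n. mn (l - x n) \<le> 3 / 2 * (1 / 3) ^ n"
proof -
  have close': "mn (x (n + k) - x n) \<le> 3 / 2 * ((1 / 3) ^ n - (1 / 3) ^ (n + k))" for n k
  proof (induction k)
    case (Suc k)
    have "mn (x (n + Suc k) - x n) \<le> mn (x (Suc (n + k)) - x (n + k)) + mn (x (n + k) - x n)"
      using module_norm_triangle[of "x (Suc (n + k)) - x (n + k)" "x (n + k) - x n"] by simp
    moreover have eq: "(1 / 3 :: real) ^ (n + Suc k) = (1 / 3) ^ (n + k) / 3" by simp
    ultimately show ?case unfolding eq using Suc step[of "n + k"] by argo
  qed (simp add: module_norm_zero)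
  have close: "mn (x m - x n) \<le> 3 / 2 * (1 / 3) ^ n" if "n \<le> m" for m n
  proof -
    have "mn (x m - x n) \<le> 3 / 2 * ((1 / 3) ^ n - (1 / 3) ^ m)"
      using close'[of n "m - n"] that by simp
    also have "\<dots> \<le> 3 / 2 * (1 / 3) ^ n" by simp
    finally show ?thesis .
  qed
  have "\<exists>l. (\<lambda>n. mn (x n - l)) \<longlonglongrightarrow> 0"
  proof (rule complete, intro allI impI)
    fix e :: real assume "0 < e"
    then obtain N where N: "(1 / 3) ^ N < e / 3"
      using real_arch_pow_inv[of "e / 3" "1 / 3"] by auto
    have "mn (x m - x n) < e" if "N \<le> m" "N \<le> n" for m n
    proof -
      have "mn (x m - x n) \<le> mn (x m - x N) + mn (x n - x N)"
        using module_norm_triangle[of "x m - x N" "x N - x n"] module_norm_minus_commute[of "x n" "x N"]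
        by simp
      then show ?thesis using close[of N m] close[of N n] that N by linarith
    qed
    then show "\<exists>N. \<forall>m\<ge>N. \<forall>n\<ge>N. mn (x m - x n) < e" by blast
  qed
  then obtain l where l: "(\<lambda>n. mn (x n - l)) \<longlonglongrightarrow> 0" by blast
  have "mn (l - x n) \<le> 3 / 2 * (1 / 3) ^ n" for n
  proof (rule LIMSEQ_le_const)
    show "(\<lambda>m. mn (x m - l) + 3 / 2 * (1 / 3) ^ n) \<longlonglongrightarrow> 3 / 2 * (1 / 3) ^ n"
      using tendsto_add[OF l tendsto_const] by simp
    have "mn (l - x n) \<le> mn (x m - l) + 3 / 2 * (1 / 3) ^ n" if "n \<le> m" for m
      using module_norm_triangle[of "l - x m" "x m - x n"] module_norm_minus_commute[of "x m" l]
        close[OF that] by simp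
    then show "\<exists>N. \<forall>m\<ge>N. mn (l - x n) \<le> mn (x m - l) + 3 / 2 * (1 / 3) ^ n" by blast
  qed
  then show ?thesis by blast
qed

section \<open>Boundedness of adjointable maps\<close>

context
  fixes T S :: "'e \<Rightarrow> 'e" assumes adj: "\<And>x y. ip (T x) y = ip x (S y)"
begin

lemma adjointable_scaleC: "T (c *\<^sub>C x) = c *\<^sub>C T x"
  by (rule ip_eqI) (simp add: adj ip_scaleC_left)

lemma adjointable_act: "T (act x a) = act (T x) a"
  by (rule ip_eqI) (simp add: adj ip_act_left)

text \<open>Sokal's gliding-hump proof of the uniform boundedness principle, applied to the functionals
  \<open>ip (T y)\<close>: they are pointwise bounded by \<open>norm (ip (T y) x) = norm (ip y (S x)) \<le> mn y * mn (S x)\<close>.\<close>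

lemma adjointable_bounded: "\<exists>C\<ge>0. \<forall>x. mn (T x) \<le> C * mn x"
proof (rule ccontr)
  assume "\<not> ?thesis"
  then have "\<exists>y. \<not> mn (T y) \<le> 4 ^ n * mn y" for n :: nat
    by (meson zero_le_numeral zero_le_power)
  then obtain y where y: "\<And>n. 4 ^ n * mn (y n) < mn (T (y n))"
    by (metis not_le)
  have pos: "0 < mn (T (y n))" for n
    using y[of n] module_norm_nonneg[of "y n"] by (smt (verit) zero_le_mult_iff zero_le_power)
  \<comment> \<open>The hump points along \<open>T (y n)\<close>, where the functional
    \<open>ip (T (y n))\<close> attains its norm, and is scaled to module norm
    \<open>(1 / 3) ^ n\<close>.\<close>
  define \<xi> where "\<xi> n = complex_of_real ((1 / 3) ^ n / mn (T (y n))) *\<^sub>C T (y n)" for n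
  have mn_xi: "mn (\<xi> n) = (1 / 3) ^ n" for n
    using pos[of n] by (simp add: \<xi>_def module_norm_scaleC norm_divide norm_power del: of_real_divide of_real_power)
  have ip_xi: "norm (ip (T (y n)) (\<xi> n)) = (1 / 3) ^ n * mn (T (y n))" for n
    using pos[of n]
    by (simp add: \<xi>_def ip_scaleC_right norm_scaleC norm_ip_self power2_eq_square norm_divide norm_power
        del: of_real_divide of_real_power)
  define x where "x = rec_nat 0 (\<lambda>n u.
    if (1 / 3) ^ n * mn (T (y n)) \<le> norm (ip (T (y n)) (u + \<xi> n)) then u + \<xi> n else u - \<xi> n)"
  have x_Suc: "x (Suc n) = (if (1 / 3) ^ n * mn (T (y n)) \<le> norm (ip (T (y n)) (x n + \<xi> n))
      then x n + \<xi> n else x n - \<xi> n)" for n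
    by (simp add: x_def)
  \<comment> \<open>The values at \<open>x n + \<xi> n\<close> and \<open>x n - \<xi> n\<close>
    differ by twice the value at \<open>\<xi> n\<close>, so at least one of them is as large as the
    latter in norm.\<close>
  have hump: "(1 / 3) ^ n * mn (T (y n)) \<le> norm (ip (T (y n)) (x (Suc n)))" for n
  proof (cases "(1 / 3) ^ n * mn (T (y n)) \<le> norm (ip (T (y n)) (x n + \<xi> n))")
    case False
    let ?f = "ip (T (y n))"
    have "?f (\<xi> n) + ?f (\<xi> n) = ?f (x n + \<xi> n) - ?f (x n - \<xi> n)"
      by (simp add: ip_add_right ip_diff_right)
    moreover have "norm (?f (\<xi> n) + ?f (\<xi> n)) = 2 * norm (?f (\<xi> n))"
      by (simp flip: scaleR_2)
    ultimately have "2 * norm (?f (\<xi> n)) \<le> norm (?f (x n + \<xi> n)) + norm (?f (x n - \<xi> n))"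
      by (metis norm_triangle_ineq4)
    then show ?thesis using False by (simp add: x_Suc ip_xi)
  qed (simp add: x_Suc)
  have "mn (x (Suc n) - x n) \<le> (1 / 3) ^ n" for n
    using module_norm_scaleC[of "-1" "\<xi> n"] by (auto simp: x_Suc mn_xi)
  then obtain l where l: "\<And>n. mn (l - x n) \<le> 3 / 2 * (1 / 3) ^ n"
    using geometric_steps_converge by blast
  \<comment> \<open>Passing from \<open>x (Suc n)\<close> to the limit \<open>l\<close> costs at
    most half of the hump, so the other half survives.\<close>
  have bound: "(1 / 3) ^ n * mn (T (y n)) / 2 \<le> mn (y n) * mn (S l)" for n
  proof -
    let ?f = "ip (T (y n))"
    have "norm (?f (x (Suc n))) \<le> norm (?f l) + norm (?f (l - x (Suc n)))"
      using norm_triangle_ineq4[of "?f l" "?f (l - x (Suc n))"] by (simp flip: ip_diff_right)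
    moreover have "norm (?f (l - x (Suc n))) \<le> mn (T (y n)) * (3 / 2 * (1 / 3) ^ Suc n)"
      using l[of "Suc n"] pos[of n]
      by (intro order_trans[OF module_Cauchy_Schwarz mult_left_mono]) simp_all
    moreover have "mn (T (y n)) * (3 / 2 * (1 / 3) ^ Suc n) = (1 / 3) ^ n * mn (T (y n)) / 2"
      by simp
    moreover have "norm (?f l) \<le> mn (y n) * mn (S l)"
      unfolding adj by (rule module_Cauchy_Schwarz)
    ultimately show ?thesis using hump[of n] by linarith
  qed
  have ypos: "0 < mn (y n)" for n
  proof (rule ccontr)
    assume "\<not> 0 < mn (y n)"
    then have "mn (y n) = 0" using module_norm_nonneg[of "y n"] by simp
    moreover have "0 < (1 / 3) ^ n * mn (T (y n)) / 2" using pos[of n] by simp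
    ultimately show False using bound[of n] by simp
  qed
  \<comment> \<open>Growth \<open>4 ^ n\<close> against humps of size \<open>(1 / 3) ^ n\<close>
    leaves \<open>(4 / 3) ^ n\<close>, which eventually exceeds the fixed bound.\<close>
  obtain n where n: "2 * mn (S l) < (4 / 3) ^ n"
    using real_arch_pow[of "4 / 3" "2 * mn (S l)"] by auto
  have "(4 / 3) ^ n * mn (y n) = (1 / 3) ^ n * (4 ^ n * mn (y n))"
    by (simp add: power_divide)
  also have "\<dots> < (1 / 3) ^ n * mn (T (y n))"
    using y[of n] by (intro mult_strict_left_mono) auto
  also have "\<dots> \<le> 2 * (mn (y n) * mn (S l))"
    using bound[of n] by argo
  finally show False
    using mult_strict_right_mono[OF n ypos[of n]] by argo
qed

lemma adjointable_character_bounded: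
  "\<exists>C\<ge>0. \<forall>\<phi>\<in>characters. \<forall>x. sn \<phi> (T x) \<le> C * sn \<phi> x"
proof -
  obtain C where C: "C \<ge> 0" "\<And>x. mn (T x) \<le> C * mn x" using adjointable_bounded by blast
  have "sn \<phi> (T x) \<le> (C * 2) * sn \<phi> x" if \<phi>: "\<phi> \<in> characters" for \<phi> x
  proof (cases "sn \<phi> x = 0")
    case True
    \<comment> \<open>A null vector of \<open>sn \<phi>\<close> leaves no positive \<open>s\<close>
      for a cutoff; moving \<open>T\<close> to the other side and applying Cauchy-Schwarz shows that
      \<open>T x\<close> is null too.\<close>
    have "(sn \<phi> (T x))\<^sup>2 = cmod (\<phi> (ip (T x) (T x)))"
      by (simp add: character_ip_self[OF \<phi>] norm_power)
    also have "\<dots> \<le> 0"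
      using character_Cauchy_Schwarz[OF \<phi>, of x "S (T x)"] True by (simp add: adj)
    finally show ?thesis using True by simp
  next
    case False
    define s where "s = (sn \<phi> x)\<^sup>2"
    have s: "s > 0" using False by (simp add: s_def)
    \<comment> \<open>A cutoff: multiplying \<open>x\<close> by \<open>f (ip x x)\<close> does not change it at \<open>\<phi>\<close>, but makes its
      module norm comparable to \<open>sn \<phi> x\<close>.\<close>
    define f where "f t = 2 * (t / s) / (1 + (t / s)\<^sup>2)" for t
    have "continuous_on {0..} f"
      unfolding f_def using s
      by (intro continuous_intros) (auto simp: add_nonneg_eq_0_iff)
    then have "\<exists>a. \<forall>\<psi>\<in>characters. \<psi> a = complex_of_real (f (Re (\<psi> (ip x x))))"
      by (intro functional_calculus) (auto simp: f_def intro: character_positive[OF _ ip_positive])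
    then obtain a where a: "\<And>\<psi>. \<psi> \<in> characters \<Longrightarrow> \<psi> a = complex_of_real (f ((sn \<psi> x)\<^sup>2))"
      by (auto simp: character_ip_self)
    have "\<phi> a = 1" using s by (simp add: a[OF \<phi>] f_def flip: s_def)
    then have "sn \<phi> (T x) = sn \<phi> (T (act x a))"
      by (simp add: adjointable_act character_seminorm_act[OF \<phi>])
    also have "\<dots> \<le> C * mn (act x a)"
      using character_seminorm_le_module_norm[OF \<phi>] C(2) order_trans by blast
    also have "\<dots> \<le> C * (2 * sn \<phi> x)"
    proof (rule mult_left_mono[OF module_norm_le C(1)])
      fix \<psi> :: "'a \<Rightarrow> complex" assume \<psi>: "\<psi> \<in> characters"
      define t u where "t = (sn \<psi> x)\<^sup>2" and "u = t / s"
      have u: "0 \<le> u" using s by (simp add: u_def t_def)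
      show "sn \<psi> (act x a) \<le> 2 * sn \<phi> x"
      proof (rule power2_le_imp_le)
        \<comment> \<open>The cutoff is \<open>2 * u / (1 + u\<^sup>2)\<close>: it is 1 at
          \<open>u = 1\<close> and decays fast enough that its square times \<open>u\<close> is at
          most 4, whence the factor 2.\<close>
        have "u * u\<^sup>2 \<le> (1 + u\<^sup>2) * (1 + u\<^sup>2)"
        proof (rule mult_mono)
          show "u \<le> 1 + u\<^sup>2"
            using zero_le_power2[of "u - 1"] u by (simp add: power2_diff)
        qed (use u in auto)
        moreover have "0 < (1 + u\<^sup>2) * (1 + u\<^sup>2)"
          using add_pos_nonneg[OF zero_less_one zero_le_power2[of u]] by simp
        ultimately have "4 * (u * u\<^sup>2) / ((1 + u\<^sup>2) * (1 + u\<^sup>2)) \<le> 4"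
          by (subst pos_divide_le_eq) auto
        moreover have "(f t)\<^sup>2 * u = 4 * (u * u\<^sup>2) / ((1 + u\<^sup>2) * (1 + u\<^sup>2))"
          by (simp add: f_def power_divide power_mult_distrib power2_eq_square flip: u_def)
        ultimately have "(f t)\<^sup>2 * u \<le> 4" by simp
        then have "(f t)\<^sup>2 * t \<le> 4 * s"
          using s by (simp add: u_def field_simps)
        then show "(sn \<psi> (act x a))\<^sup>2 \<le> (2 * sn \<phi> x)\<^sup>2"
          by (simp add: character_seminorm_act[OF \<psi>] a[OF \<psi>] power_mult_distrib s_def t_def)
      qed (simp add: character_seminorm_nonneg[OF \<phi>])
    qed (simp add: character_seminorm_nonneg[OF \<phi>])
    finally show ?thesis by simp
  qed
  then show ?thesis using C(1) by (intro exI[of _ "C * 2"]) auto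
qed

end

section \<open>The norm axioms for the triple norm\<close>

lemma triple_norm_values_eq:
  "triple_norm_values ip T = {sn \<phi> (T x) | x \<phi>. \<phi> \<in> characters \<and> sn \<phi> x = 1}"
  unfolding triple_norm_values_def
  by (intro Collect_cong ex_cong1) (auto simp: character_module_abs)

lemma triple_norm_values_bdd_above:
  assumes "T \<in> adjointable_maps ip"
  shows "bdd_above (triple_norm_values ip T)"
proof -
  obtain C where C: "\<And>\<phi> x. \<phi> \<in> characters \<Longrightarrow> sn \<phi> (T x) \<le> C * sn \<phi> x"
    using assms adjointable_character_bounded unfolding adjointable_maps_def by blast
  show ?thesis
  proof (rule bdd_aboveI)
    fix v assume "v \<in> triple_norm_values ip T"
    then obtain x \<phi> where "\<phi> \<in> characters" "v = sn \<phi> (T x)" "sn \<phi> x = 1"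
      unfolding triple_norm_values_eq by blast
    then show "v \<le> C" using C[of \<phi> x] by simp
  qed
qed

lemma character_seminorm_le_triple_norm:
  assumes T: "T \<in> adjointable_maps ip" and \<phi>: "\<phi> \<in> characters"
  shows "sn \<phi> (T x) \<le> triple_norm ip T * sn \<phi> x"
proof -
  obtain S where adj: "\<And>x y. ip (T x) y = ip x (S y)" using T by (auto simp: adjointable_maps_def)
  show ?thesis
  proof (cases "sn \<phi> x = 0")
    case True
    \<comment> \<open>Such an \<open>x\<close> cannot be normalized, so the supremum says nothing
      about it; the character-wise bound gives \<open>sn \<phi> (T x) \<le> 0\<close>.\<close>
    obtain C where "sn \<phi> (T x) \<le> C * sn \<phi> x"
      using adjointable_character_bounded[OF adj] \<phi> by blast
    then show ?thesis using True by simp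
  next
    case False
    then have pos: "sn \<phi> x > 0" using character_seminorm_nonneg[OF \<phi>, of x] by simp
    define c where "c = complex_of_real (inverse (sn \<phi> x))"
    have c: "cmod c = inverse (sn \<phi> x)" using pos unfolding c_def by (simp only: norm_of_real) simp
    have "sn \<phi> (c *\<^sub>C x) = 1" using pos by (simp add: character_seminorm_scaleC[OF \<phi>] c)
    then have mem: "sn \<phi> (T (c *\<^sub>C x)) \<in> triple_norm_values ip T"
      unfolding triple_norm_values_eq using \<phi> by blast
    then have "sn \<phi> (T (c *\<^sub>C x)) \<le> triple_norm ip T"
      unfolding triple_norm_def using cSup_upper[OF mem triple_norm_values_bdd_above[OF T]] by auto
    then show ?thesis using pos
      by (simp add: adjointable_scaleC[OF adj] character_seminorm_scaleC[OF \<phi>] c field_simps)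
  qed
qed

text \<open>\<open>0 \<le> C\<close> covers the default value 0 taken when the set of values is
  empty.\<close>

lemma triple_norm_le:
  assumes "0 \<le> C" "\<And>\<phi> x. \<phi> \<in> characters \<Longrightarrow> sn \<phi> (T x) \<le> C * sn \<phi> x"
  shows "triple_norm ip T \<le> C"
proof -
  have "v \<le> C" if v: "v \<in> triple_norm_values ip T" for v
  proof -
    obtain x \<phi> where "\<phi> \<in> characters" "v = sn \<phi> (T x)" "sn \<phi> x = 1"
      using v unfolding triple_norm_values_eq by blast
    then show ?thesis using assms(2)[of \<phi> x] by simp
  qed
  then show ?thesis
    unfolding triple_norm_def using assms(1) by (simp add: cSup_least)
qed

lemma triple_norm_nonneg:
  assumes "T \<in> adjointable_maps ip"
  shows "0 \<le> triple_norm ip T"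
proof (cases "triple_norm_values ip T = {}")
  case False
  then obtain v where v: "v \<in> triple_norm_values ip T" by blast
  then have "0 \<le> v" using character_seminorm_nonneg by (auto simp: triple_norm_values_eq)
  then show ?thesis
    using cSup_upper[OF v triple_norm_values_bdd_above[OF assms]] False by (simp add: triple_norm_def)
qed (simp add: triple_norm_def)

lemma adjointable_maps_zero: "0 \<in> adjointable_maps ip"
  unfolding adjointable_maps_def by (auto intro!: exI[of _ "\<lambda>_. 0"])

lemma adjointable_maps_add:
  "T \<in> adjointable_maps ip \<Longrightarrow> U \<in> adjointable_maps ip \<Longrightarrow> T + U \<in> adjointable_maps ip"
  unfolding adjointable_maps_def
proof safe
  fix S R assume "\<forall>x y. ip (T x) y = ip x (S y)" "\<forall>x y. ip (U x) y = ip x (R y)"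
  then show "\<exists>S. \<forall>x y. ip ((T + U) x) y = ip x (S y)"
    by (intro exI[of _ "\<lambda>y. S y + R y"]) (simp add: ip_add_left ip_add_right)
qed

lemma adjointable_maps_scaleC:
  "T \<in> adjointable_maps ip \<Longrightarrow> c *\<^sub>C T \<in> adjointable_maps ip"
  unfolding adjointable_maps_def
proof safe
  fix S assume "\<forall>x y. ip (T x) y = ip x (S y)"
  then show "\<exists>S. \<forall>x y. ip ((c *\<^sub>C T) x) y = ip x (S y)"
    by (intro exI[of _ "\<lambda>y. cnj c *\<^sub>C S y"]) (simp add: scaleC_fun_def ip_scaleC_left ip_scaleC_right)
qed

lemma triple_norm_eq_0_iff:
  assumes T: "T \<in> adjointable_maps ip"
  shows "triple_norm ip T = 0 \<longleftrightarrow> T = 0"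
proof
  assume N: "triple_norm ip T = 0"
  have "T x = 0" for x
  proof -
    have "mn (T x) \<le> 0"
      using character_seminorm_le_triple_norm[OF T] by (intro module_norm_le) (auto simp: N)
    then show ?thesis
      using module_norm_nonneg[of "T x"] by (intro ip_definite) (simp add: module_norm_def)
  qed
  then show "T = 0" by (simp add: fun_eq_iff)
next
  assume "T = 0"
  then have "triple_norm ip T \<le> 0"
    by (intro triple_norm_le) (auto simp: character_seminorm_def character_zero)
  then show "triple_norm ip T = 0" using triple_norm_nonneg[OF T] by simp
qed

lemma triple_norm_scaleC_le:
  assumes T: "T \<in> adjointable_maps ip"
  shows "triple_norm ip (c *\<^sub>C T) \<le> cmod c * triple_norm ip T"
proof (rule triple_norm_le)
  fix \<phi> :: "'a \<Rightarrow> complex" and x assume \<phi>: "\<phi> \<in> characters"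
  show "sn \<phi> ((c *\<^sub>C T) x) \<le> cmod c * triple_norm ip T * sn \<phi> x"
    using character_seminorm_le_triple_norm[OF T \<phi>, of x]
    by (simp add: scaleC_fun_def character_seminorm_scaleC[OF \<phi>] mult.assoc mult_left_mono)
qed (simp add: triple_norm_nonneg[OF T])

lemma triple_norm_scaleC:
  assumes T: "T \<in> adjointable_maps ip"
  shows "triple_norm ip (c *\<^sub>C T) = cmod c * triple_norm ip T"
proof (cases "c = 0")
  case True
  then show ?thesis
    using triple_norm_scaleC_le[OF T, of c] triple_norm_nonneg[OF adjointable_maps_scaleC[OF T], of c]
    by simp
next
  case False
  have "triple_norm ip T \<le> cmod (inverse c) * triple_norm ip (c *\<^sub>C T)"
    using triple_norm_scaleC_le[OF adjointable_maps_scaleC[OF T, of c], of "inverse c"] False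
    by (simp add: scaleC_scaleC scaleC_one)
  then have "cmod c * triple_norm ip T \<le> triple_norm ip (c *\<^sub>C T)"
    using False by (simp add: norm_inverse norm_divide field_simps)
  then show ?thesis using triple_norm_scaleC_le[OF T, of c] by simp
qed

lemma triple_norm_triangle:
  assumes T: "T \<in> adjointable_maps ip" and U: "U \<in> adjointable_maps ip"
  shows "triple_norm ip (T + U) \<le> triple_norm ip T + triple_norm ip U"
proof (rule triple_norm_le)
  fix \<phi> :: "'a \<Rightarrow> complex" and x assume \<phi>: "\<phi> \<in> characters"
  show "sn \<phi> ((T + U) x) \<le> (triple_norm ip T + triple_norm ip U) * sn \<phi> x"
    using character_seminorm_triangle[OF \<phi>, of "T x" "U x"]
      character_seminorm_le_triple_norm[OF T \<phi>, of x] character_seminorm_le_triple_norm[OF U \<phi>, of x]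
    by (simp add: distrib_right)
qed (simp add: triple_norm_nonneg T U)

end

text \<open>Boundedness above is part of the conclusion because it makes the real \<open>Sup\<close>
  of a nonempty value set a genuine, finite supremum.\<close>

theorem mainTheorem4:
  fixes act :: "'e::complex_vector \<Rightarrow> 'a::abelian_cstar_algebra \<Rightarrow> 'e"
    and ip :: "'e \<Rightarrow> 'e \<Rightarrow> 'a"
  assumes "hilbert_module act ip"
  shows "complex_vector.subspace (adjointable_maps ip) \<and>
    (\<forall>T\<in>adjointable_maps ip. bdd_above (triple_norm_values ip T)) \<and>
    is_norm_on (adjointable_maps ip) (triple_norm ip)"
proof -
  interpret abelian_hilbert_module act ip
    using assms by (rule abelian_hilbert_module.intro)
  show ?thesis
    unfolding is_norm_on_def complex_vector.subspace_def
    by (simp add: adjointable_maps_zero adjointable_maps_add adjointable_maps_scaleC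
        triple_norm_values_bdd_above triple_norm_nonneg triple_norm_eq_0_iff triple_norm_scaleC
        triple_norm_triangle)
qed

end
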